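(* Let $\mathbb{F}$ be a field. There is a deterministic algorithm that, given a noncommutative arithmetic circuit $C$ with the promise that $C$ computes a polynomial $f\in\mathbb{F}\{x_1,\ldots,x_n\}$ of degree $d$ with at most $t$ monomials, checks whether $f$ is identically zero in time $\mathrm{poly}(|C|,d,n,t)$. In particular, if $f$ is sparse (polynomially many monomials) and of polynomial degree, this is a deterministic polynomial-time algorithm.
   Context: $\mathbb{F}\{x_1,\ldots,x_n\}$ is the ring of polynomials in noncommuting variables over $\mathbb{F}$. A noncommutative arithmetic circuit takes as inputs the variables $x_i$ and scalars from $\mathbb{F}$, and has addition gates and order-respecting multiplication gates; $|C|$ denotes its size. *)

theory Defs
  imports Complex_Main "HOL-Library.Poly_Mapping"
begin

section \<open>Polynomials in noncommuting variables\<close>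

text \<open>The free monoid, written additively, because \<open>Poly_Mapping\<close> takes its exponents from a
  \<open>monoid_add\<close>. The letter \<open>i\<close> stands for the variable \<open>x_(i+1)\<close>, so the polynomials in
  \<open>n\<close> variables use the letters \<open>i < n\<close>.\<close>

datatype word = Word (letters: "nat list")

instantiation word :: monoid_add
begin

definition zero_word :: word where "0 = Word []"

definition plus_word :: "word \<Rightarrow> word \<Rightarrow> word" where
  "u + v = Word (letters u @ letters v)"

instance
  by standard (simp_all add: zero_word_def plus_word_def)

end

text \<open>The monoid algebra of the free monoid; its convolution product is the order-respecting
  product of noncommutative polynomials.\<close>

type_synonym 'a ncpoly = "word \<Rightarrow>\<^sub>0 'a"

definition nc_var :: "nat \<Rightarrow> 'a::field ncpoly" where
  "nc_var i = Poly_Mapping.single (Word [i]) 1"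

definition nc_const :: "'a::field \<Rightarrow> 'a ncpoly" where
  "nc_const a = Poly_Mapping.single 0 a"

lemma monomial_times_monomial:
  "Poly_Mapping.single (Word u) a * Poly_Mapping.single (Word v) b
     = Poly_Mapping.single (Word (u @ v)) (a * b :: 'a::field)"
  by (simp add: mult_single plus_word_def)

text \<open>The zero polynomial gets degree 0.\<close>

definition nc_degree :: "'a::field ncpoly \<Rightarrow> nat" where
  "nc_degree f = Max (insert 0 ((\<lambda>w. length (letters w)) ` Poly_Mapping.keys f))"

definition num_monomials :: "'a::field ncpoly \<Rightarrow> nat" where
  "num_monomials f = card (Poly_Mapping.keys f)"


section \<open>Noncommutative arithmetic circuits\<close>

text \<open>A circuit is a directed acyclic graph of gates listed in topological order; addition and
  multiplication gates have fan-in two (left operand, right operand) and refer to their operands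
  by position in the list. The last gate is the output gate.\<close>

datatype 'a gate = Input nat | Scalar 'a | Add nat nat | Mul nat nat

type_synonym 'a circuit = "'a gate list"

fun wf_gate :: "nat \<Rightarrow> nat \<Rightarrow> 'a gate \<Rightarrow> bool" where
  "wf_gate n k (Input i) \<longleftrightarrow> i < n"
| "wf_gate n k (Scalar a) \<longleftrightarrow> True"
| "wf_gate n k (Add l r) \<longleftrightarrow> l < k \<and> r < k"
| "wf_gate n k (Mul l r) \<longleftrightarrow> l < k \<and> r < k"

definition wf_circuit :: "nat \<Rightarrow> 'a circuit \<Rightarrow> bool" where
  "wf_circuit n C \<longleftrightarrow> C \<noteq> [] \<and> (\<forall>k < length C. wf_gate n k (C ! k))"

abbreviation circuit_size :: "'a circuit \<Rightarrow> nat" where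
  "circuit_size C \<equiv> length C"

fun gate_poly :: "'a ncpoly list \<Rightarrow> 'a::field gate \<Rightarrow> 'a ncpoly" where
  "gate_poly vs (Input i) = nc_var i"
| "gate_poly vs (Scalar a) = nc_const a"
| "gate_poly vs (Add l r) = vs ! l + vs ! r"
| "gate_poly vs (Mul l r) = vs ! l * vs ! r"

definition circuit_poly :: "'a::field circuit \<Rightarrow> 'a ncpoly" where
  "circuit_poly C = last (foldl (\<lambda>vs g. vs @ [gate_poly vs g]) [] C)"


section \<open>Algorithms over a field\<close>

text \<open>The machine model is the unit-cost random access machine over a field (as in algebraic
  complexity), in structured form. The store consists of arrays of natural numbers and arrays of
  field elements; a program mentions only finitely many arrays by name, but addresses their cells
  indirectly. Natural numbers admit only addition and truncated subtraction (no multiplication),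
  so that unit cost is polynomially equivalent to bit cost on the discrete part. Field elements
  are accessible only through the field operations and equality tests; programs contain no field
  constants other than 0 and 1. Expressions do not contribute to the cost individually: their
  sizes are fixed by the program, which only affects constant factors.\<close>

record 'a store =
  nats :: "nat \<Rightarrow> nat \<Rightarrow> nat"
  flds :: "nat \<Rightarrow> nat \<Rightarrow> 'a"

datatype nexp =
    NNum nat
  | NCell nat nexp  \<comment> \<open>array name, index\<close>
  | NPlus nexp nexp
  | NMinus nexp nexp

datatype fexp =
    FZero
  | FOne
  | FCell nat nexp
  | FPlus fexp fexp
  | FMinus fexp fexp
  | FTimes fexp fexp
  | FDivide fexp fexp

datatype bexp =
    NLess nexp nexp
  | NEq nexp nexp
  | FEq fexp fexp
  | BNot bexp
  | BAnd bexp bexp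

datatype com =
    Skip
  | NAssign nat nexp nexp  \<comment> \<open>array name, index, new value\<close>
  | FAssign nat nexp fexp
  | Seq com com
  | If bexp com com
  | While bexp com

fun nval :: "nexp \<Rightarrow> 'a store \<Rightarrow> nat" where
  "nval (NNum k) s = k"
| "nval (NCell a e) s = nats s a (nval e s)"
| "nval (NPlus e1 e2) s = nval e1 s + nval e2 s"
| "nval (NMinus e1 e2) s = nval e1 s - nval e2 s"

fun fval :: "fexp \<Rightarrow> 'a::field store \<Rightarrow> 'a" where
  "fval FZero s = 0"
| "fval FOne s = 1"
| "fval (FCell a e) s = flds s a (nval e s)"
| "fval (FPlus e1 e2) s = fval e1 s + fval e2 s"
| "fval (FMinus e1 e2) s = fval e1 s - fval e2 s"
| "fval (FTimes e1 e2) s = fval e1 s * fval e2 s"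
| "fval (FDivide e1 e2) s = fval e1 s / fval e2 s"

fun bval :: "bexp \<Rightarrow> 'a::field store \<Rightarrow> bool" where
  "bval (NLess e1 e2) s \<longleftrightarrow> nval e1 s < nval e2 s"
| "bval (NEq e1 e2) s \<longleftrightarrow> nval e1 s = nval e2 s"
| "bval (FEq e1 e2) s \<longleftrightarrow> fval e1 s = fval e2 s"
| "bval (BNot b) s \<longleftrightarrow> \<not> bval b s"
| "bval (BAnd b1 b2) s \<longleftrightarrow> bval b1 s \<and> bval b2 s"

definition write_cell :: "(nat \<Rightarrow> nat \<Rightarrow> 'b) \<Rightarrow> nat \<Rightarrow> nat \<Rightarrow> 'b \<Rightarrow> nat \<Rightarrow> nat \<Rightarrow> 'b" where
  "write_cell m a i x = m(a := (m a)(i := x))"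

text \<open>\<open>exec c s T s'\<close>: started in \<open>s\<close>, the program \<open>c\<close> halts in \<open>s'\<close> after \<open>T\<close> steps.\<close>

inductive exec :: "com \<Rightarrow> 'a::field store \<Rightarrow> nat \<Rightarrow> 'a store \<Rightarrow> bool" where
  Skip: "exec Skip s 1 s"
| NAssign: "exec (NAssign a i e) s 1 (s\<lparr>nats := write_cell (nats s) a (nval i s) (nval e s)\<rparr>)"
| FAssign: "exec (FAssign a i e) s 1 (s\<lparr>flds := write_cell (flds s) a (nval i s) (fval e s)\<rparr>)"
| Seq: "exec c1 s T1 s1 \<Longrightarrow> exec c2 s1 T2 s2 \<Longrightarrow> exec (Seq c1 c2) s (T1 + T2) s2"
| IfTrue: "bval b s \<Longrightarrow> exec c1 s T s' \<Longrightarrow> exec (If b c1 c2) s (T + 1) s'"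
| IfFalse: "\<not> bval b s \<Longrightarrow> exec c2 s T s' \<Longrightarrow> exec (If b c1 c2) s (T + 1) s'"
| WhileFalse: "\<not> bval b s \<Longrightarrow> exec (While b c) s 1 s"
| WhileTrue: "bval b s \<Longrightarrow> exec c s T1 s1 \<Longrightarrow> exec (While b c) s1 T2 s2
    \<Longrightarrow> exec (While b c) s (T1 + T2 + 1) s2"

inductive_cases exec_SkipE: "exec Skip s T s'"
inductive_cases exec_NAssignE: "exec (NAssign a i e) s T s'"
inductive_cases exec_FAssignE: "exec (FAssign a i e) s T s'"
inductive_cases exec_SeqE: "exec (Seq c1 c2) s T s'"
inductive_cases exec_IfE: "exec (If b c1 c2) s T s'"
inductive_cases exec_WhileE: "exec (While b c) s T s'"

lemma exec_deterministic:
  "exec c s T s' \<Longrightarrow> exec c s U s'' \<Longrightarrow> U = T \<and> s'' = s'"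
proof (induction arbitrary: U s'' rule: exec.induct)
  case (Skip s)
  from Skip.prems show ?case by (rule exec_SkipE) simp
next
  case (NAssign a i e s)
  from NAssign.prems show ?case by (rule exec_NAssignE) simp
next
  case (FAssign a i e s)
  from FAssign.prems show ?case by (rule exec_FAssignE) simp
next
  case (Seq c1 s T1 s1 c2 T2 s2)
  from Seq.prems obtain U1 U2 r where "U = U1 + U2" "exec c1 s U1 r" "exec c2 r U2 s''"
    by (rule exec_SeqE)
  with Seq.IH show ?case by metis
next
  case (IfTrue b s c1 T s' c2)
  from IfTrue.prems IfTrue.hyps(1) obtain V where "U = V + 1" "exec c1 s V s''"
    by (auto elim: exec_IfE)
  with IfTrue.IH show ?case by metis
next
  case (IfFalse b s c2 T s' c1)
  from IfFalse.prems IfFalse.hyps(1) obtain V where "U = V + 1" "exec c2 s V s''"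
    by (auto elim: exec_IfE)
  with IfFalse.IH show ?case by metis
next
  case (WhileFalse b s c)
  from WhileFalse.prems show ?case
    by (rule exec_WhileE) (use WhileFalse.hyps in simp_all)
next
  case (WhileTrue b s c T1 s1 T2 s2)
  from WhileTrue.prems obtain U1 U2 r
    where "U = U1 + U2 + 1" "exec c s U1 r" "exec (While b c) r U2 s''"
    by (rule exec_WhileE) (use WhileTrue.hyps(1) in simp_all)
  with WhileTrue.IH show ?case by metis
qed


section \<open>The identity testing problem\<close>

text \<open>Input format: array 0 of natural numbers holds \<open>n\<close>, \<open>d\<close>, \<open>t\<close> and the number of gates;
  arrays 1, 2, 3 hold the opcode and the operands of each gate; array 0 of field elements holds
  the scalars of the scalar gates. All other cells are 0.\<close>

fun opcode :: "'a gate \<Rightarrow> nat" where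
  "opcode (Input i) = 0"
| "opcode (Scalar a) = 1"
| "opcode (Add l r) = 2"
| "opcode (Mul l r) = 3"

fun operand1 :: "'a gate \<Rightarrow> nat" where
  "operand1 (Input i) = i"
| "operand1 (Scalar a) = 0"
| "operand1 (Add l r) = l"
| "operand1 (Mul l r) = l"

fun operand2 :: "'a gate \<Rightarrow> nat" where
  "operand2 (Input i) = 0"
| "operand2 (Scalar a) = 0"
| "operand2 (Add l r) = r"
| "operand2 (Mul l r) = r"

fun scalar :: "'a::field gate \<Rightarrow> 'a" where
  "scalar (Input i) = 0"
| "scalar (Scalar a) = a"
| "scalar (Add l r) = 0"
| "scalar (Mul l r) = 0"

definition array_of :: "'b::zero list \<Rightarrow> nat \<Rightarrow> 'b" where
  "array_of xs i = (if i < length xs then xs ! i else 0)"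

definition input_store :: "nat \<Rightarrow> nat \<Rightarrow> nat \<Rightarrow> 'a::field circuit \<Rightarrow> 'a store" where
  "input_store n d t C = \<lparr>
     nats = (\<lambda>_ _. 0)(
       0 := array_of [n, d, t, length C],
       1 := array_of (map opcode C),
       2 := array_of (map operand1 C),
       3 := array_of (map operand2 C)),
     flds = (\<lambda>_ _. 0)(0 := array_of (map scalar C))\<rparr>"

text \<open>The parameters \<open>d\<close> and \<open>t\<close> are upper bounds on the degree and the number of monomials;
  in particular the zero polynomial satisfies the promise for all \<open>d\<close> and \<open>t\<close>.\<close>

definition promise :: "nat \<Rightarrow> nat \<Rightarrow> nat \<Rightarrow> 'a::field circuit \<Rightarrow> bool" where
  "promise n d t C \<longleftrightarrow> wf_circuit n C \<and>
     nc_degree (circuit_poly C) \<le> d \<and> num_monomials (circuit_poly C) \<le> t"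

text \<open>The verdict is left in cell 0 of array 0: 1 for identically zero, 0 otherwise.\<close>

definition tests_zero_within ::
    "com \<Rightarrow> nat \<Rightarrow> nat \<Rightarrow> nat \<Rightarrow> 'a::field circuit \<Rightarrow> nat \<Rightarrow> bool" where
  "tests_zero_within P n d t C B \<longleftrightarrow>
     (\<exists>T s. exec P (input_store n d t C) T s \<and> T \<le> B \<and>
        nats s 0 0 = (if circuit_poly C = 0 then 1 else 0))"

end

theory Submission
  imports Defs
begin

text \<open>Send a word \<open>w\<close> over \<open>n\<close> letters to the pair of its length and of \<open>h w mod m\<close>, where \<open>h w\<close> is the
  value of \<open>w\<close> read in base \<open>n\<close>. The pair of \<open>u v\<close> is determined by those of \<open>u\<close> and \<open>v\<close>, because
  \<open>h (u v) = h u * n ^ length v + h v\<close>. Hence the sums of the coefficients of \<open>f\<close> over all words with a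
  given pair can be computed gate by gate, and truncating at length \<open>d + 1\<close> keeps the tables small.
  If \<open>f\<close> is nonzero, fix one of its words \<open>w\<close>. If each \<open>m \<le> n d t + 2\<close> made \<open>w\<close> collide with another
  word of \<open>f\<close> of the same length, each such \<open>m\<close> would divide the product of the fewer than \<open>t\<close>
  differences \<open>h w - h w'\<close>, which is at most \<open>2 ^ (n d t)\<close>; but a positive common multiple of
  \<open>1, ..., M\<close> is at least \<open>2 ^ (M - 1)\<close>. So for some \<open>m\<close> the sum belonging to \<open>w\<close> is the coefficient of
  \<open>w\<close>, and it suffices to test whether all tables for \<open>m \<le> n d t + 2\<close> vanish.\<close>

section \<open>Isolating a word by its hash value\<close>

text \<open>Leibniz's harmonic triangle: with \<open>L n k = 1 / ((n + 1) (n choose k))\<close> one has \<open>L n 0 = 1 / (n + 1)\<close>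
  and \<open>L n (k + 1) = L (n - 1) k - L n k\<close>, so \<open>D * L n k\<close> stays an integer.\<close>

lemma harmonic_triangle:
  fixes D :: nat
  assumes "\<And>m. 1 \<le> m \<Longrightarrow> m \<le> Suc n \<Longrightarrow> m dvd D" and "k \<le> n"
  shows "Suc n * (n choose k) dvd D"
proof -
  \<comment> \<open>Divisibility is recast as integrality of a quotient, because integrality passes
    through the subtraction in the recurrence.\<close>
  have "(of_nat D :: rat) / of_nat (Suc n * (n choose k)) \<in> \<int>"
    using assms
  proof (induction k arbitrary: n)
    case 0
    then have "Suc n dvd D" by simp
    then obtain q where "D = Suc n * q" by (elim dvdE)
    then show ?case
      by (simp del: of_nat_Suc mult_Suc)
  next
    case (Suc k)
    from Suc.prems(2) obtain n' where n: "n = Suc n'" by (cases n) auto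
    with Suc.prems have k: "k \<le> n'" by simp
    \<comment> \<open>With these, \<open>a / x\<close> and \<open>a / y\<close> are
      \<open>n choose Suc k\<close> and \<open>n choose k\<close>, and \<open>x + y\<close> is
      \<open>Suc n\<close>; the recurrence becomes
      \<open>x / ((x + y) * a) = 1 / a - y / ((x + y) * a)\<close>.\<close>
    define x y where "x = (of_nat (Suc k) :: rat)" and "y = (of_nat (n - k) :: rat)"
    define a where "a = (of_nat (Suc n' * (n' choose k)) :: rat)"
    have a: "a > 0" using k by (simp add: a_def del: of_nat_Suc mult_Suc)
    have xy: "x > 0" "y > 0" "x + y = of_nat (Suc n)"
      using n k by (simp_all add: x_def y_def of_nat_diff)
    have "Suc k * (n choose Suc k) = Suc n' * (n' choose k)"
      using Suc_times_binomial_eq[of n' k] unfolding n by (metis mult.commute)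
    then have 1: "x * of_nat (n choose Suc k) = a"
      unfolding x_def a_def by (metis of_nat_mult)
    have "(n - k) * (n choose k) = Suc n' * (n' choose k)"
      using binomial_absorb_comp[of n k] by (simp add: n)
    then have 2: "y * of_nat (n choose k) = a"
      unfolding y_def a_def by (metis of_nat_mult)
    have 3: "of_nat (n choose Suc k) = a / x" "of_nat (n choose k) = a / y"
      using 1 2 xy by (auto simp: field_simps)
    have "(of_nat D :: rat) / of_nat (Suc n * (n choose Suc k))
        = of_nat D / a - of_nat D / of_nat (Suc n * (n choose k))"
      unfolding of_nat_mult 3 xy(3)[symmetric] using a xy(1,2) add_pos_pos[OF xy(1,2)]
      by (simp add: divide_simps) (simp add: algebra_simps)
    moreover have "of_nat D / a \<in> \<int>"
      unfolding a_def using Suc.prems k by (intro Suc.IH) (auto simp: n)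
    moreover have "(of_nat D :: rat) / of_nat (Suc n * (n choose k)) \<in> \<int>"
      using Suc.prems by (intro Suc.IH) auto
    ultimately show ?case by (metis Ints_diff)
  qed
  then obtain z where z: "(of_nat D :: rat) / of_nat (Suc n * (n choose k)) = of_int z"
    by (elim Ints_cases)
  have "Suc n * (n choose k) > 0" using assms(2) by simp
  then have "(of_nat D :: rat) = of_nat (Suc n * (n choose k)) * of_int z"
    using z by (simp add: field_simps del: of_nat_mult of_nat_Suc mult_Suc)
  then have "int D = int (Suc n * (n choose k)) * z"
    by (metis of_int_eq_iff of_int_mult of_int_of_nat_eq)
  then show ?thesis by (metis dvd_triv_left int_dvd_int_iff)
qed

text \<open>Each entry of row \<open>n\<close> of Pascal's triangle, times \<open>Suc n\<close>,
  divides \<open>D\<close>. Adding these \<open>n + 1\<close> bounds compares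
  \<open>Suc n * 2 ^ n\<close> with \<open>Suc n * D\<close>.\<close>

lemma power_two_le_common_multiple:
  fixes D :: nat
  assumes "\<And>m. 1 \<le> m \<Longrightarrow> m \<le> Suc n \<Longrightarrow> m dvd D" and "D > 0"
  shows "2 ^ n \<le> D"
proof -
  have "Suc n * (n choose k) \<le> D" if "k \<le> n" for k
    using harmonic_triangle[OF assms(1) that] assms(2) by (metis dvd_imp_le)
  then have "(\<Sum>k\<le>n. Suc n * (n choose k)) \<le> (\<Sum>k\<le>n. D)"
    by (intro sum_mono) auto
  then have "Suc n * 2 ^ n \<le> Suc n * D"
    by (simp only: sum_distrib_left[symmetric] choose_row_sum) simp
  then show ?thesis by (simp only: Suc_mult_le_cancel1)
qed

section \<open>Words as base-n numerals\<close>

text \<open>Horner's rule with the letters as digits. Leading zeros do not show in the value, so the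
  length of a word has to be kept beside it.\<close>

definition hash :: "nat \<Rightarrow> word \<Rightarrow> nat" where
  "hash n w = foldl (\<lambda>h x. h * n + x) 0 (letters w)"

abbreviation wlen :: "word \<Rightarrow> nat" where
  "wlen w \<equiv> length (letters w)"

lemma foldl_hash_start:
  "foldl (\<lambda>h x. h * n + x) a xs = a * n ^ length xs + foldl (\<lambda>h x. h * n + x) (0::nat) xs"
proof (induction xs rule: rev_induct)
  case (snoc x xs)
  show ?case by (simp add: snoc) (simp add: algebra_simps)
qed simp

lemma wlen_plus: "wlen (u + v) = wlen u + wlen v"
  by (simp add: plus_word_def)

lemma hash_plus: "hash n (u + v) = hash n u * n ^ wlen v + hash n v"
  by (simp add: hash_def plus_word_def) (rule foldl_hash_start)

lemma foldl_hash_less: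
  "set xs \<subseteq> {..<n} \<Longrightarrow> foldl (\<lambda>h x. h * n + x) (0::nat) xs < n ^ length xs"
proof (induction xs rule: rev_induct)
  case (snoc x xs)
  define h where "h = foldl (\<lambda>h x. h * n + x) (0::nat) xs"
  have "Suc h \<le> n ^ length xs" "x < n" using snoc by (auto simp: h_def)
  then have "h * n + x < Suc h * n" "Suc h * n \<le> n ^ length xs * n"
    by (auto simp only: mult_le_mono1) simp
  then show ?case by (simp add: h_def mult.commute)
qed simp

text \<open>The last digit is the remainder modulo \<open>n\<close>, so digits can be peeled off
  from the right; equal lengths make both words end together.\<close>

lemma foldl_hash_inj:
  "length xs = length ys \<Longrightarrow> set xs \<subseteq> {..<n} \<Longrightarrow> set ys \<subseteq> {..<n} \<Longrightarrow>
   foldl (\<lambda>h x. h * n + x) (0::nat) xs = foldl (\<lambda>h x. h * n + x) (0::nat) ys \<Longrightarrow> xs = ys"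
proof (induction xs arbitrary: ys rule: rev_induct)
  case (snoc x xs)
  from snoc.prems(1) obtain y ys' where ys: "ys = ys' @ [y]" by (cases ys rule: rev_cases) auto
  define h h' where "h = foldl (\<lambda>h x. h * n + x) (0::nat) xs" and "h' = foldl (\<lambda>h x. h * n + x) (0::nat) ys'"
  have lt: "x < n" "y < n" and eq: "h * n + x = h' * n + y"
    using snoc.prems by (auto simp: ys h_def h'_def)
  have "x = (h * n + x) mod n" "y = (h' * n + y) mod n" using lt by auto
  with eq have "x = y" by simp
  with eq lt have "h = h'" by simp
  with \<open>x = y\<close> snoc show ?case by (auto simp: ys h_def h'_def)
qed simp

definition words_over :: "nat \<Rightarrow> word set" where
  "words_over n = {w. set (letters w) \<subseteq> {..<n}}"

lemma hash_less: "w \<in> words_over n \<Longrightarrow> hash n w < n ^ wlen w"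
  unfolding hash_def words_over_def by (auto intro: foldl_hash_less)

lemma hash_inj:
  "u \<in> words_over n \<Longrightarrow> v \<in> words_over n \<Longrightarrow> wlen u = wlen v \<Longrightarrow> hash n u = hash n v \<Longrightarrow> u = v"
  unfolding hash_def words_over_def
  by (cases u; cases v) (auto dest: foldl_hash_inj)

lemma isolating_modulus:
  assumes fin: "finite K" and K: "K \<subseteq> words_over n" and len: "\<And>v. v \<in> K \<Longrightarrow> wlen v \<le> d"
    and card: "card K \<le> t" and w: "w \<in> K"
  shows "\<exists>m. 1 \<le> m \<and> m \<le> n * d * t + 2 \<and>
    (\<forall>v\<in>K. wlen v = wlen w \<longrightarrow> hash n v mod m = hash n w mod m \<longrightarrow> v = w)"
proof (rule ccontr)
  assume contra: "\<not> ?thesis"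
  define K' where "K' = {v \<in> K. wlen v = wlen w \<and> v \<noteq> w}"
  \<comment> \<open>The difference is taken over the integers because subtraction of natural numbers
    truncates.\<close>
  define diff where "diff v = nat \<bar>int (hash n v) - int (hash n w)\<bar>" for v
  define D where "D = (\<Prod>v\<in>K'. diff v)"
  have finK': "finite K'" using fin by (simp add: K'_def)
  have pos: "diff v > 0" if "v \<in> K'" for v
    using that hash_inj[of v n w] K w by (auto simp: K'_def diff_def)
  then have "D > 0" by (simp add: D_def prod_pos)
  moreover have "m dvd D" if "1 \<le> m" "m \<le> Suc (n * d * t + 1)" for m
  proof -
    from contra that obtain v where v: "v \<in> K'" "hash n v mod m = hash n w mod m"
      by (auto simp: K'_def)
    then have "int (hash n v) mod int m = int (hash n w) mod int m"
      by (metis of_nat_mod)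
    then have "int m dvd int (hash n v) - int (hash n w)"
      by (simp add: mod_eq_dvd_iff)
    then have "m dvd diff v"
      by (simp add: diff_def dvd_nat_abs_iff)
    also have "\<dots> dvd D" unfolding D_def using finK' v(1) by (rule dvd_prodI)
    finally show ?thesis .
  qed
  \<comment> \<open>The common-multiple bound loses one in the exponent, so moduli up to
    \<open>n * d * t + 2\<close> give \<open>2 ^ (n * d * t + 1)\<close>, just above the upper bound
    \<open>2 ^ (n * d * t)\<close> derived next.\<close>
  ultimately have "2 ^ (n * d * t + 1) \<le> D"
    by (intro power_two_le_common_multiple)
  have "diff v \<le> 2 ^ (n * d)" if "v \<in> K'" for v
  proof -
    have v: "v \<in> K" "wlen v = wlen w" "wlen v \<le> d" using that len[of v] by (auto simp: K'_def)
    have "hash n v < n ^ wlen v" "hash n w < n ^ wlen v"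
      using hash_less[of v n] hash_less[of w n] v K w by auto
    then have "diff v \<le> n ^ wlen v" by (auto simp: diff_def)
    \<comment> \<open>Replacing \<open>n\<close> by \<open>2 ^ n\<close> brings the bound to base 2
      without logarithms.\<close>
    also have "n ^ wlen v \<le> (2 ^ n) ^ wlen v" by (intro power_mono) (auto intro: less_imp_le)
    also have "\<dots> \<le> (2 ^ n) ^ d" using v by (intro power_increasing) auto
    finally show ?thesis by (simp add: power_mult)
  qed
  then have "D \<le> (\<Prod>v\<in>K'. 2 ^ (n * d))"
    unfolding D_def by (intro prod_mono) auto
  also have "\<dots> = (2 ^ (n * d)) ^ card K'" by simp
  also have "\<dots> \<le> (2 ^ (n * d)) ^ t"
    using card card_mono[of K K'] fin by (intro power_increasing) (auto simp: K'_def)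
  also have "\<dots> < 2 ^ (n * d * t + 1)" by (simp add: power_mult)
  finally show False using \<open>2 ^ (n * d * t + 1) \<le> D\<close> by simp
qed


section \<open>Tables of coefficient sums\<close>

text \<open>The linear functional on the monoid algebra with value \<open>\<phi> w\<close> at the
  word \<open>w\<close>. Indicator functions for \<open>\<phi>\<close> will give the table
  entries.\<close>

definition lin :: "(word \<Rightarrow> 'a::field) \<Rightarrow> 'a ncpoly \<Rightarrow> 'a" where
  "lin \<phi> p = (\<Sum>w\<in>Poly_Mapping.keys p. Poly_Mapping.lookup p w * \<phi> w)"

lemma lin_single [simp]: "lin \<phi> (Poly_Mapping.single w a) = a * \<phi> w"
  by (simp add: lin_def)

lemma lin_zero [simp]: "lin \<phi> 0 = 0"
  by (simp add: lin_def)

lemma lin_add: "lin \<phi> (p + q) = lin \<phi> p + lin \<phi> q"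
  unfolding lin_def
  by (rule setsum_keys_plus_distrib) (simp_all add: algebra_simps)

lemma lin_scale_fun: "lin (\<lambda>w. a * \<phi> w) p = a * lin \<phi> p"
  unfolding lin_def sum_distrib_left by (simp only: mult.left_commute)

lemma lin_scale_fun_right: "lin (\<lambda>w. \<phi> w * a) p = lin \<phi> p * a"
  by (simp add: lin_def sum_distrib_right mult.assoc)

lemma lin_sum_fun: "lin (\<lambda>w. \<Sum>i\<in>I. \<phi> i w) p = (\<Sum>i\<in>I. lin (\<phi> i) p)"
  unfolding lin_def by (simp add: sum_distrib_left) (rule sum.swap)

text \<open>The rule \<open>update_induct\<close> inserts one fresh key at a time; read as the
  addition of a monomial, such a step is accessible to \<open>lin_add\<close>.\<close>

lemma update_new_key:
  "w \<notin> Poly_Mapping.keys p \<Longrightarrow> Poly_Mapping.update w a p = p + Poly_Mapping.single w a"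
  by (rule poly_mapping_eqI)
    (auto simp: lookup_update lookup_add lookup_single not_in_keys_iff_lookup_eq_zero when_def)

text \<open>Both sides are bilinear in \<open>p\<close> and \<open>q\<close>, so monomials suffice;
  the outer induction takes \<open>p\<close> apart, the inner one \<open>q\<close>.\<close>

lemma lin_mult: "lin \<phi> (p * q) = lin (\<lambda>u. lin (\<lambda>v. \<phi> (u + v)) q) p"
proof (induction p rule: update_induct)
  case (update p w a)
  have "lin \<phi> (Poly_Mapping.single w a * q) = a * lin (\<lambda>v. \<phi> (w + v)) q"
    by (induction q rule: update_induct)
      (simp_all add: update_new_key distrib_left lin_add mult_single algebra_simps)
  with update show ?case
    by (simp add: update_new_key distrib_right lin_add)
qed simp

section \<open>Tables indexed by length and residue\<close>

text \<open>Row-major layout: a row of width \<open>m\<close> for each length, with the residue as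
  column.\<close>

definition cell :: "nat \<Rightarrow> nat \<Rightarrow> word \<Rightarrow> nat" where
  "cell n m w = wlen w * m + hash n w mod m"

definition table :: "nat \<Rightarrow> nat \<Rightarrow> 'a::field ncpoly \<Rightarrow> nat \<Rightarrow> 'a" where
  "table n m p j = lin (\<lambda>w. if cell n m w = j then 1 else 0) p"

definition mult_cell :: "nat \<Rightarrow> nat \<Rightarrow> nat \<Rightarrow> nat \<Rightarrow> nat \<Rightarrow> nat \<Rightarrow> nat" where
  "mult_cell n m l1 l2 s1 s2 = (l1 + l2) * m + (s1 * n ^ l2 + s2) mod m"

lemma cell_plus:
  "cell n m (u + v) = mult_cell n m (wlen u) (wlen v) (hash n u mod m) (hash n v mod m)"
  unfolding cell_def mult_cell_def wlen_plus hash_plus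
  by (metis mod_add_cong mod_mod_trivial mod_mult_left_eq)

lemma cell_eq_iff:
  "s < m \<Longrightarrow> cell n m w = l * m + s \<longleftrightarrow> wlen w = l \<and> hash n w mod m = s"
proof
  assume "s < m" "cell n m w = l * m + s"
  then have "(cell n m w) div m = l" "(cell n m w) mod m = s" by simp_all
  then show "wlen w = l \<and> hash n w mod m = s"
    using \<open>s < m\<close> by (simp add: cell_def)
qed (simp add: cell_def)

lemma table_zero [simp]: "table n m 0 j = 0"
  by (simp add: table_def)

lemma table_add: "table n m (p + q) j = table n m p j + table n m q j"
  by (simp add: table_def lin_add)

lemma table_const: "table n m (nc_const a) j = (if j = 0 then a else 0)"
  by (auto simp: table_def nc_const_def cell_def zero_word_def hash_def)

lemma table_var: "table n m (nc_var x) j = (if j = m + x mod m then 1 else 0)"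
  by (auto simp: table_def nc_var_def cell_def hash_def)

text \<open>For given words \<open>u\<close> and \<open>v\<close> at most one quadruple of lengths
  and residues in range matches, so the indicator of the cell of \<open>u + v\<close> is a sum of
  products of indicators for \<open>u\<close> and for \<open>v\<close>. Applying \<open>lin\<close>
  in both variables turns these into products of table entries.\<close>

lemma table_mult:
  assumes j: "j < L * m"
  shows "table n m (p * q) j = (\<Sum>l1<L. \<Sum>l2<L - l1. \<Sum>s1<m. \<Sum>s2<m.
    if j = mult_cell n m l1 l2 s1 s2 then table n m p (l1 * m + s1) * table n m q (l2 * m + s2) else 0)"
proof -
  from j have m: "m > 0" by (cases m) auto
  define \<delta> where "\<delta> u c = (if cell n m u = c then 1 else 0 :: 'a)" for u c
  define g where "g u v l1 l2 s1 s2 = (if j = mult_cell n m l1 l2 s1 s2 then 1 else 0)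
    * (\<delta> u (l1 * m + s1) * \<delta> v (l2 * m + s2))" for u v l1 l2 s1 s2
  have pointwise: "\<delta> (u + v) j = (\<Sum>l1<L. \<Sum>l2<L - l1. \<Sum>s1<m. \<Sum>s2<m. g u v l1 l2 s1 s2)" for u v
  proof -
    \<comment> \<open>Kronecker delta: with the summand written as a product containing four of
      these, the sums collapse one after another.\<close>
    define e where "e x y = (if x = y then 1 else 0 :: 'a)" for x y :: nat
    have e_sum: "(\<Sum>i<N. e i a * f i) = (if a < N then f a else 0)" for a N :: nat and f
      by (simp add: e_def if_distrib[of "\<lambda>x. x * _"] sum.delta cong: if_cong)
    have "(\<Sum>l1<L. \<Sum>l2<L - l1. \<Sum>s1<m. \<Sum>s2<m. g u v l1 l2 s1 s2)
      = (\<Sum>l1<L. \<Sum>l2<L - l1. \<Sum>s1<m. \<Sum>s2<m. e l1 (wlen u) * (e l2 (wlen v)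
           * (e s1 (hash n u mod m) * (e s2 (hash n v mod m) * \<delta> (u + v) j))))"
      by (intro sum.cong refl) (auto simp: g_def e_def \<delta>_def cell_eq_iff cell_plus)
    also have "\<dots> = (\<Sum>l1<L. e l1 (wlen u) * (\<Sum>l2<L - l1. e l2 (wlen v)
           * (\<Sum>s1<m. e s1 (hash n u mod m) * (\<Sum>s2<m. e s2 (hash n v mod m) * \<delta> (u + v) j))))"
      by (simp only: sum_distrib_left)
    also have "\<dots> = (if wlen u + wlen v < L then \<delta> (u + v) j else 0)"
      using m by (auto simp: e_sum)
    also have "\<dots> = \<delta> (u + v) j"
    proof -
      \<comment> \<open>Pairs outside the range of summation have total length at least
        \<open>L\<close>, so their cell has index at least \<open>L * m\<close> and misses
        \<open>j\<close>.\<close>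
      have "cell n m (u + v) \<noteq> j" if "\<not> wlen u + wlen v < L"
      proof -
        have "L * m \<le> (wlen u + wlen v) * m" using that by (intro mult_le_mono1) simp
        with j have "j < (wlen u + wlen v) * m" by (rule less_le_trans)
        then show ?thesis by (simp add: cell_def wlen_plus)
      qed
      then show ?thesis by (auto simp: \<delta>_def)
    qed
    finally show ?thesis by simp
  qed
  have prod: "lin (\<lambda>u. lin (\<lambda>v. g u v l1 l2 s1 s2) q) p
    = (if j = mult_cell n m l1 l2 s1 s2
       then table n m p (l1 * m + s1) * table n m q (l2 * m + s2) else 0)" for l1 l2 s1 s2
    unfolding g_def lin_scale_fun lin_scale_fun_right by (simp add: table_def \<delta>_def)
  have "table n m (p * q) j = lin (\<lambda>u. lin (\<lambda>v. \<delta> (u + v) j) q) p"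
    by (simp add: table_def lin_mult \<delta>_def)
  then show ?thesis
    by (simp only: pointwise lin_sum_fun prod)
qed

lemma table_of_isolated:
  assumes "m > 0"
    and "\<And>v. v \<in> Poly_Mapping.keys p \<Longrightarrow> wlen v = wlen w \<Longrightarrow> hash n v mod m = hash n w mod m \<Longrightarrow> v = w"
  shows "table n m p (cell n m w) = Poly_Mapping.lookup p w"
proof -
  have "cell n m v = cell n m w \<longleftrightarrow> v = w" if "v \<in> Poly_Mapping.keys p" for v
    using assms that cell_eq_iff[of "hash n w mod m" m n v "wlen w"] by (auto simp: cell_def)
  then have "table n m p (cell n m w) =
      (\<Sum>v\<in>Poly_Mapping.keys p. if v = w then Poly_Mapping.lookup p v else 0)"
    unfolding table_def lin_def by (intro sum.cong) auto
  then show ?thesis by (simp add: in_keys_iff)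
qed

definition nonvanishing :: "nat \<Rightarrow> nat \<Rightarrow> nat \<Rightarrow> 'a::field ncpoly \<Rightarrow> bool" where
  "nonvanishing n L m p \<longleftrightarrow> (\<exists>j<L * m. table n m p j \<noteq> 0)"

lemma zero_iff_vanishing:
  fixes p :: "'a::field ncpoly"
  assumes over: "Poly_Mapping.keys p \<subseteq> words_over n" and deg: "nc_degree p \<le> d"
    and num: "num_monomials p \<le> t"
  shows "p = 0 \<longleftrightarrow> (\<forall>k<n * d * t + 2. \<not> nonvanishing n (d + 2) (Suc k) p)"
proof
  assume "p = 0"
  then show "\<forall>k<n * d * t + 2. \<not> nonvanishing n (d + 2) (Suc k) p"
    by (simp add: nonvanishing_def)
next
  assume van: "\<forall>k<n * d * t + 2. \<not> nonvanishing n (d + 2) (Suc k) p"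
  show "p = 0"
  proof (rule ccontr)
    assume "p \<noteq> 0"
    then obtain w where w: "w \<in> Poly_Mapping.keys p"
      by (metis in_keys_iff lookup_zero poly_mapping_eqI)
    have len: "wlen v \<le> d" if "v \<in> Poly_Mapping.keys p" for v
    proof -
      have "wlen v \<le> nc_degree p" unfolding nc_degree_def using that by (intro Max_ge) auto
      with deg show ?thesis by simp
    qed
    from isolating_modulus[OF finite_keys over len num[unfolded num_monomials_def] w] obtain m where
      m: "1 \<le> m" "m \<le> n * d * t + 2" and
      iso: "\<forall>v\<in>Poly_Mapping.keys p. wlen v = wlen w \<longrightarrow> hash n v mod m = hash n w mod m \<longrightarrow> v = w"
      by blast
    have "table n m p (cell n m w) \<noteq> 0"
      using table_of_isolated[of m p w n] m iso w by (auto simp: in_keys_iff)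
    \<comment> \<open>As lengths are at most \<open>d\<close>, the cell lies within the first
      \<open>d + 1\<close> rows.\<close>
    moreover have "cell n m w < (d + 2) * m"
    proof -
      have "hash n w mod m < m" using m by simp
      moreover have "wlen w * m \<le> d * m" using len[OF w] by (rule mult_le_mono1)
      ultimately have "cell n m w < d * m + m" unfolding cell_def by linarith
      then show ?thesis by (simp add: add_mult_distrib)
    qed
    ultimately have "nonvanishing n (d + 2) m p" by (auto simp: nonvanishing_def)
    moreover have "m - 1 < n * d * t + 2" "Suc (m - 1) = m" using m by simp_all
    ultimately show False using van by metis
  qed
qed


section \<open>Circuit evaluation\<close>

text \<open>\<open>circuit_poly\<close> keeps only the last entry of this list; the invariant of the
  evaluation refers to all of them.\<close>

definition gate_vals :: "'a::field circuit \<Rightarrow> 'a ncpoly list" where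
  "gate_vals C = foldl (\<lambda>vs g. vs @ [gate_poly vs g]) [] C"

lemma length_gate_vals [simp]: "length (gate_vals C) = length C"
  unfolding gate_vals_def by (induction C rule: rev_induct) auto

lemma gate_poly_append:
  "wf_gate n (length vs) g \<Longrightarrow> gate_poly (vs @ ws) g = gate_poly vs g"
  by (cases g) (auto simp: nth_append)

text \<open>Each gate is evaluated on the values before it, and a well-formed gate does not see what
  is appended later. This yields a recursion on the final list, free of the fold.\<close>

lemma gate_vals_nth:
  assumes "\<forall>k<length C. wf_gate n k (C ! k)" "k < length C"
  shows "gate_vals C ! k = gate_poly (gate_vals C) (C ! k)"
  using assms
proof (induction C arbitrary: k rule: rev_induct)
  case (snoc g C)
  have vals: "gate_vals (C @ [g]) = gate_vals C @ [gate_poly (gate_vals C) g]"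
    by (simp add: gate_vals_def)
  have wf: "wf_gate n j ((C @ [g]) ! j)" if "j \<le> length C" for j
    using snoc.prems(1) that by auto
  have wfC: "\<forall>j<length C. wf_gate n j (C ! j)"
    using wf by (metis nth_append less_imp_le)
  show ?case
  proof (cases "k < length C")
    case True
    have wfk: "wf_gate n (length (gate_vals C)) (C ! k)"
      using wfC[rule_format, OF True] True by (cases "C ! k") auto
    show ?thesis
      using True snoc.IH[OF wfC True]
      by (simp add: vals nth_append gate_poly_append[OF wfk])
  next
    case False
    with snoc.prems have k: "k = length C" by simp
    with wf[of k] have wfk: "wf_gate n (length (gate_vals C)) g" by simp
    show ?thesis by (simp add: vals k nth_append gate_poly_append[OF wfk])
  qed
qed simp

lemma circuit_poly_nth:
  "C \<noteq> [] \<Longrightarrow> circuit_poly C = gate_vals C ! (length C - 1)"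
  unfolding circuit_poly_def gate_vals_def[symmetric]
  by (metis last_conv_nth length_0_conv length_gate_vals)

text \<open>\<open>hash_inj\<close> asks for letters below \<open>n\<close>. Input gates provide
  them, and products only concatenate words.\<close>

lemma gate_vals_words_over:
  assumes wf: "\<forall>k<length C. wf_gate n k (C ! k)" and "k < length C"
  shows "Poly_Mapping.keys (gate_vals C ! k) \<subseteq> words_over n"
  using assms(2)
proof (induction k rule: less_induct)
  case (less k)
  have v: "gate_vals C ! k = gate_poly (gate_vals C) (C ! k)"
    using gate_vals_nth[OF wf less.prems] .
  have IH: "Poly_Mapping.keys (gate_vals C ! j) \<subseteq> words_over n" if "j < k" for j
    using less that by simp
  have wfk: "wf_gate n k (C ! k)" using wf less.prems by simp
  show ?case
  proof (cases "C ! k")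
    case (Mul l r)
    have "u + v \<in> words_over n" if "u \<in> words_over n" "v \<in> words_over n" for u v
      using that by (auto simp: words_over_def plus_word_def)
    moreover have "Poly_Mapping.keys (gate_vals C ! l) \<subseteq> words_over n"
      "Poly_Mapping.keys (gate_vals C ! r) \<subseteq> words_over n"
      using wfk Mul IH by simp_all
    moreover have "gate_vals C ! k = gate_vals C ! l * gate_vals C ! r"
      using v Mul by simp
    ultimately show ?thesis
      using keys_mult[of "gate_vals C ! l" "gate_vals C ! r"] by (simp only:) blast
  next
    case (Add l r)
    then show ?thesis
      using v wfk IH keys_add[of "gate_vals C ! l" "gate_vals C ! r"] by fastforce
  qed (use v wfk in \<open>auto simp: nc_var_def nc_const_def words_over_def zero_word_def\<close>)
qed

section \<open>Reasoning about programs\<close>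

fun nreads :: "nexp \<Rightarrow> nat set" where
  "nreads (NNum k) = {}"
| "nreads (NCell a e) = insert a (nreads e)"
| "nreads (NPlus e1 e2) = nreads e1 \<union> nreads e2"
| "nreads (NMinus e1 e2) = nreads e1 \<union> nreads e2"

fun nwrites :: "com \<Rightarrow> nat set" where
  "nwrites Skip = {}"
| "nwrites (NAssign a i e) = {a}"
| "nwrites (FAssign a i e) = {}"
| "nwrites (Seq c1 c2) = nwrites c1 \<union> nwrites c2"
| "nwrites (If b c1 c2) = nwrites c1 \<union> nwrites c2"
| "nwrites (While b c) = nwrites c"

fun fwrites :: "com \<Rightarrow> nat set" where
  "fwrites Skip = {}"
| "fwrites (NAssign a i e) = {}"
| "fwrites (FAssign a i e) = {a}"
| "fwrites (Seq c1 c2) = fwrites c1 \<union> fwrites c2"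
| "fwrites (If b c1 c2) = fwrites c1 \<union> fwrites c2"
| "fwrites (While b c) = fwrites c"

text \<open>Frames are tracked by whole arrays, not by cells, so that disjointness concerns finite
  sets of names only; scalar variables get arrays of their own to make this fine enough.\<close>

definition agree :: "nat set \<Rightarrow> nat set \<Rightarrow> 'a store \<Rightarrow> 'a store \<Rightarrow> bool" where
  "agree A B s s' \<longleftrightarrow> (\<forall>a. a \<notin> A \<longrightarrow> nats s' a = nats s a) \<and> (\<forall>a. a \<notin> B \<longrightarrow> flds s' a = flds s a)"

lemma agree_nats: "agree A B s s' \<Longrightarrow> a \<notin> A \<Longrightarrow> nats s' a = nats s a"
  and agree_flds: "agree A B s s' \<Longrightarrow> a \<notin> B \<Longrightarrow> flds s' a = flds s a"
  by (simp_all add: agree_def)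

lemma agree_trans: "agree A B s s' \<Longrightarrow> agree A B s' s'' \<Longrightarrow> agree A B s s''"
  by (simp add: agree_def)

lemma agree_mono: "agree A B s s' \<Longrightarrow> A \<subseteq> A' \<Longrightarrow> B \<subseteq> B' \<Longrightarrow> agree A' B' s s'"
  by (auto simp: agree_def)

lemma write_cell_apply: "write_cell m a i x b = (if b = a then (m a)(i := x) else m b)"
  by (simp add: write_cell_def)

lemma exec_agree: "exec c s T s' \<Longrightarrow> agree (nwrites c) (fwrites c) s s'"
  by (induction rule: exec.induct) (auto simp: agree_def write_cell_apply)

lemma nval_agree: "agree A B s s' \<Longrightarrow> nreads e \<inter> A = {} \<Longrightarrow> nval e s' = nval e s"
  by (induction e) (auto simp: agree_def Int_Un_distrib2)

section \<open>Total correctness with step bounds\<close>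

definition runs :: "com \<Rightarrow> nat \<Rightarrow> 'a::field store \<Rightarrow> ('a store \<Rightarrow> bool) \<Rightarrow> bool" where
  "runs c T s Q \<longleftrightarrow> (\<exists>T' s'. exec c s T' s' \<and> T' \<le> T \<and> Q s')"

lemma runs_agree: "runs c T s Q \<Longrightarrow> runs c T s (\<lambda>s'. Q s' \<and> agree (nwrites c) (fwrites c) s s')"
  unfolding runs_def using exec_agree by blast

lemma runs_mono: "runs c T s Q \<Longrightarrow> T \<le> T' \<Longrightarrow> (\<And>s'. Q s' \<Longrightarrow> Q' s') \<Longrightarrow> runs c T' s Q'"
  unfolding runs_def by (meson order_trans)

lemma runs_conseq:
  assumes "runs c T s Q" "\<And>s'. agree (nwrites c) (fwrites c) s s' \<Longrightarrow> Q s' \<Longrightarrow> Q' s'"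
  shows "runs c T s Q'"
  using runs_agree[OF assms(1)] by (rule runs_mono) (auto intro: assms(2))

lemma runs_Skip: "Q s \<Longrightarrow> runs Skip 1 s Q"
  unfolding runs_def by (meson exec.Skip order_refl)

lemma runs_NAssign:
  "Q (s\<lparr>nats := write_cell (nats s) a (nval i s) (nval e s)\<rparr>) \<Longrightarrow> runs (NAssign a i e) 1 s Q"
  unfolding runs_def by (intro exI conjI) (rule exec.NAssign, auto)

lemma runs_FAssign:
  "Q (s\<lparr>flds := write_cell (flds s) a (nval i s) (fval e s)\<rparr>) \<Longrightarrow> runs (FAssign a i e) 1 s Q"
  unfolding runs_def by (intro exI conjI) (rule exec.FAssign, auto)

text \<open>The frame of \<open>c1\<close> is handed on to the reasoning about \<open>c2\<close>, so
  \<open>Q1\<close> can be confined to what \<open>c1\<close> changes.\<close>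

lemma runs_Seq:
  assumes "runs c1 T1 s Q1"
    and "\<And>s1. agree (nwrites c1) (fwrites c1) s s1 \<Longrightarrow> Q1 s1 \<Longrightarrow> runs c2 T2 s1 Q"
  shows "runs (Seq c1 c2) (T1 + T2) s Q"
proof -
  from runs_agree[OF assms(1)] obtain T1' s1 where
    1: "exec c1 s T1' s1" "T1' \<le> T1" "agree (nwrites c1) (fwrites c1) s s1" "Q1 s1"
    unfolding runs_def by auto
  from assms(2)[OF 1(3,4)] obtain T2' s2 where "exec c2 s1 T2' s2" "T2' \<le> T2" "Q s2"
    unfolding runs_def by auto
  with 1 show ?thesis
    unfolding runs_def by (meson exec.Seq add_mono)
qed

lemma runs_If:
  assumes "bval b s \<Longrightarrow> runs c1 T s Q" "\<not> bval b s \<Longrightarrow> runs c2 T s Q"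
  shows "runs (If b c1 c2) (T + 1) s Q"
proof (cases "bval b s")
  case True
  from assms(1)[OF this] obtain T' s' where "exec c1 s T' s'" "T' \<le> T" "Q s'"
    unfolding runs_def by auto
  with exec.IfTrue[OF True] show ?thesis unfolding runs_def by (meson add_le_mono1)
next
  case False
  from assms(2)[OF this] obtain T' s' where "exec c2 s T' s'" "T' \<le> T" "Q s'"
    unfolding runs_def by auto
  with exec.IfFalse[OF False] show ?thesis unfolding runs_def by (meson add_le_mono1)
qed

section \<open>Counting loops\<close>

abbreviation var :: "nat \<Rightarrow> nexp" where
  "var v \<equiv> NCell v (NNum 0)"

definition For :: "nat \<Rightarrow> nexp \<Rightarrow> com \<Rightarrow> com" where
  "For v e c = Seq (NAssign v (NNum 0) (NNum 0))
     (While (NLess (var v) e) (Seq c (NAssign v (NNum 0) (NPlus (var v) (NNum 1)))))"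

text \<open>An iteration pays for the body, the increment and the test; the last 2 pays for the
  initial assignment and the failing test. \<open>X\<close> only bounds the number of iterations, so
  that all running times become functions of one variable.\<close>

definition loop_time :: "nat \<Rightarrow> nat \<Rightarrow> nat" where
  "loop_time X T = X * (T + 2) + 2"

lemma nwrites_For [simp]: "nwrites (For v e c) = insert v (nwrites c)"
  and fwrites_For [simp]: "fwrites (For v e c) = fwrites c"
  by (auto simp: For_def)

text \<open>The limit \<open>e\<close> is evaluated anew at each test, so the body must leave alone
  what it reads. The invariant takes the counter as an argument, and \<open>stable\<close> carries
  it across assignments to the counter variable.\<close>

lemma runs_For:
  assumes v: "v \<notin> nwrites c" and e: "nreads e \<inter> insert v (nwrites c) = {}"
    and N: "nval e s = N" "N \<le> X"
    and init: "I 0 s"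
    and step: "\<And>k s'. k < N \<Longrightarrow> agree (insert v (nwrites c)) (fwrites c) s s' \<Longrightarrow>
      nats s' v 0 = k \<Longrightarrow> I k s' \<Longrightarrow> runs c T s' (I (Suc k))"
    and stable: "\<And>k s' s''. agree {v} {} s' s'' \<Longrightarrow> I k s' \<Longrightarrow> I k s''"
  shows "runs (For v e c) (loop_time X T) s (I N)"
proof -
  let ?A = "insert v (nwrites c)" and ?B = "fwrites c"
  let ?body = "Seq c (NAssign v (NNum 0) (NPlus (var v) (NNum 1)))"
  have loop: "runs (While (NLess (var v) e) ?body) ((N - k) * (T + 2) + 1) s' (I N)"
    if "k \<le> N" "agree ?A ?B s s'" "nats s' v 0 = k" "I k s'" for k s'
    using that
  proof (induction "N - k" arbitrary: k s')
    case 0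
    then have "\<not> bval (NLess (var v) e) s'"
      using nval_agree[OF 0(3) e] N by simp
    with 0 show ?case
      unfolding runs_def by (auto intro!: exI[of _ 1] exI[of _ s'] exec.WhileFalse)
  next
    case (Suc x)
    then have k: "k < N" by simp
    have b: "bval (NLess (var v) e) s'"
      using nval_agree[OF Suc.prems(2) e] N Suc.prems k by simp
    from runs_agree[OF step[OF k Suc.prems(2,3,4)]] obtain T1 s1 where
      1: "exec c s' T1 s1" "T1 \<le> T" "I (Suc k) s1" "agree (nwrites c) ?B s' s1"
      unfolding runs_def by auto
    define s2 where "s2 = s1\<lparr>nats := write_cell (nats s1) v 0 (nats s1 v 0 + 1)\<rparr>"
    have "exec (NAssign v (NNum 0) (NPlus (var v) (NNum 1))) s1 1 s2"
      using exec.NAssign[of v "NNum 0" "NPlus (var v) (NNum 1)" s1] by (simp add: s2_def)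
    with 1 have body: "exec ?body s' (T1 + 1) s2" by (blast intro: exec.Seq)
    have "agree {v} {} s1 s2" by (simp add: agree_def s2_def write_cell_apply)
    then have I: "I (Suc k) s2" using 1 stable by blast
    have "agree ?A ?B s1 s2" by (rule agree_mono[OF \<open>agree {v} {} s1 s2\<close>]) auto
    moreover have "agree ?A ?B s' s1" by (rule agree_mono[OF 1(4)]) auto
    ultimately have "agree ?A ?B s s2" using Suc.prems(2) agree_trans by blast
    moreover have "nats s2 v 0 = Suc k"
      using agree_nats[OF 1(4) v] Suc.prems by (simp add: s2_def write_cell_apply)
    ultimately have "runs (While (NLess (var v) e) ?body) ((N - Suc k) * (T + 2) + 1) s2 (I N)"
      using Suc.hyps(2) k I by (intro Suc.hyps(1)) auto
    then obtain T2 s3 where 2: "exec (While (NLess (var v) e) ?body) s2 T2 s3"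
      "T2 \<le> (N - Suc k) * (T + 2) + 1" "I N s3"
      unfolding runs_def by auto
    have "N - k = Suc (N - Suc k)" using k by simp
    then have "(T1 + 1) + T2 + 1 \<le> (N - k) * (T + 2) + 1"
      using 1(2) 2(2) by simp
    with exec.WhileTrue[OF b body 2(1)] 2(3) show ?case
      unfolding runs_def by blast
  qed
  have "runs (For v e c) (1 + (N * (T + 2) + 1)) s (I N)"
    unfolding For_def
  proof (rule runs_Seq)
    let ?s0 = "s\<lparr>nats := write_cell (nats s) v 0 0\<rparr>"
    show "runs (NAssign v (NNum 0) (NNum 0)) 1 s (\<lambda>s'. s' = ?s0)"
      by (rule runs_NAssign) simp
    fix s' assume s': "s' = ?s0"
    have 0: "agree {v} {} s ?s0" by (simp add: agree_def write_cell_apply)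
    have "agree ?A ?B s ?s0" by (rule agree_mono[OF 0]) auto
    moreover have "I 0 ?s0" using stable[OF 0 init] .
    ultimately show "runs (While (NLess (var v) e) ?body) (N * (T + 2) + 1) s' (I N)"
      using loop[of 0 ?s0] by (simp add: s' write_cell_apply)
  qed
  then show ?thesis
    by (rule runs_mono) (use mult_le_mono1[OF N(2), of "T + 2"] in \<open>simp_all add: loop_time_def\<close>)
qed

text \<open>Meant for loops that add to the array \<open>a\<close>. The conclusion has the shape of
  the assumption on the body, so nested loops produce nested sums as in
  \<open>table_mult\<close>.\<close>

lemma runs_For_accumulate:
  assumes v: "v \<notin> nwrites c" and e: "nreads e \<inter> insert v (nwrites c) = {}"
    and N: "nval e s = N" "N \<le> X"
    and step: "\<And>k s'. k < N \<Longrightarrow> agree (insert v (nwrites c)) (fwrites c) s s' \<Longrightarrow>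
      nats s' v 0 = k \<Longrightarrow> runs c T s' (\<lambda>s''. \<forall>j. flds s'' a j = flds s' a j + \<delta> k j)"
  shows "runs (For v e c) (loop_time X T) s (\<lambda>s'. \<forall>j. flds s' a j = flds s a j + (\<Sum>k<N. \<delta> k j))"
proof (rule runs_For[where I = "\<lambda>k s'. \<forall>j. flds s' a j = flds s a j + (\<Sum>i<k. \<delta> i j)", OF v e N])
  show "runs c T s' (\<lambda>s'. \<forall>j. flds s' a j = flds s a j + (\<Sum>i<Suc k. \<delta> i j))"
    if "k < N" "agree (insert v (nwrites c)) (fwrites c) s s'" "nats s' v 0 = k"
      "\<forall>j. flds s' a j = flds s a j + (\<Sum>i<k. \<delta> i j)" for k s'
    using step[OF that(1-3)] by (rule runs_mono) (simp_all add: that(4))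
qed (auto simp: agree_def)

section \<open>Index tables and gate operations\<close>

text \<open>Arrays of natural numbers are called \<open>a...\<close>; a scalar variable \<open>v...\<close> is cell 0 of an array of its own.
  The coefficient sum of gate \<open>g\<close> for length \<open>l\<close> and residue \<open>k\<close> lives in cell \<open>g * (L * m) + l * m + k\<close>
  of \<open>fVal\<close>, where \<open>L = d + 2\<close>; the extra row makes room for the input gates when \<open>d = 0\<close>. As there is
  no multiplication on indices, the multiples of \<open>m\<close> and \<open>L * m\<close>, the residues \<open>k mod m\<close> and the products
  \<open>k * n ^ l mod m\<close> are tabulated by additions.\<close>

abbreviation (input) "aOp \<equiv> 1 :: nat"
abbreviation (input) "aLeft \<equiv> 2 :: nat"
abbreviation (input) "aRight \<equiv> 3 :: nat"
abbreviation (input) "vProd \<equiv> 4 :: nat"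
abbreviation (input) "vBound \<equiv> 5 :: nat"
abbreviation (input) "vRows \<equiv> 6 :: nat"
abbreviation (input) "vK \<equiv> 7 :: nat"
abbreviation (input) "vMod \<equiv> 8 :: nat"
abbreviation (input) "vRes \<equiv> 9 :: nat"
abbreviation (input) "aMod \<equiv> 10 :: nat"
abbreviation (input) "aStep \<equiv> 11 :: nat"
abbreviation (input) "aRow \<equiv> 12 :: nat"
abbreviation (input) "aBlock \<equiv> 13 :: nat"
abbreviation (input) "aShift \<equiv> 14 :: nat"
abbreviation (input) "vI \<equiv> 15 :: nat"
abbreviation (input) "vJ \<equiv> 16 :: nat"
abbreviation (input) "vGate \<equiv> 17 :: nat"
abbreviation (input) "vL1 \<equiv> 18 :: nat"
abbreviation (input) "vL2 \<equiv> 19 :: nat"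
abbreviation (input) "vS1 \<equiv> 20 :: nat"
abbreviation (input) "vS2 \<equiv> 21 :: nat"
abbreviation (input) "fScalar \<equiv> 0 :: nat"
abbreviation (input) "fVal \<equiv> 1 :: nat"
abbreviation (input) "fAcc \<equiv> 2 :: nat"
abbreviation (input) "eVars \<equiv> NCell 0 (NNum 0)"
abbreviation (input) "eDeg \<equiv> NCell 0 (NNum 1)"
abbreviation (input) "eMonos \<equiv> NCell 0 (NNum 2)"
abbreviation (input) "eGates \<equiv> NCell 0 (NNum 3)"
abbreviation (input) "succ e \<equiv> NPlus e (NNum 1)"

section \<open>Index tables built by additions\<close>

text \<open>The range up to \<open>n + 2 * m\<close> covers the letters, \<open>n\<close> itself and
  sums of two residues, which are the values reduced later.\<close>

definition mod_prog :: com where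
  "mod_prog = Seq (NAssign aMod (NNum 0) (NNum 0))
     (For vI (NPlus eVars (NPlus (var vMod) (var vMod)))
       (If (NEq (succ (NCell aMod (var vI))) (var vMod))
         (NAssign aMod (succ (var vI)) (NNum 0))
         (NAssign aMod (succ (var vI)) (succ (NCell aMod (var vI))))))"

definition step_prog :: com where
  "step_prog = Seq (NAssign aStep (NNum 0) (NNum 0))
     (For vI (var vMod)
       (NAssign aStep (succ (var vI))
         (NCell aMod (NPlus (NCell aStep (var vI)) (NCell aMod eVars)))))"

definition row_prog :: com where
  "row_prog = Seq (NAssign aRow (NNum 0) (NNum 0))
     (For vI (var vRows)
       (NAssign aRow (succ (var vI)) (NPlus (NCell aRow (var vI)) (var vMod))))"

text \<open>The entry of \<open>aRow\<close> after the last row is \<open>L * m\<close>, the length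
  of one block.\<close>

definition block_prog :: com where
  "block_prog = Seq (NAssign aBlock (NNum 0) (NNum 0))
     (For vI eGates
       (NAssign aBlock (succ (var vI)) (NPlus (NCell aBlock (var vI)) (NCell aRow (var vRows)))))"

text \<open>As \<open>k * n ^ (l + 1)\<close> and \<open>(k * n mod m) * n ^ l\<close> agree modulo
  \<open>m\<close>, row \<open>l + 1\<close> is row \<open>l\<close> read through the column map
  \<open>aStep\<close>.\<close>

definition shift_prog :: com where
  "shift_prog = Seq (For vI (var vMod) (NAssign aShift (var vI) (var vI)))
     (For vI (var vRows) (For vJ (var vMod)
       (NAssign aShift (NPlus (NCell aRow (succ (var vI))) (var vJ))
         (NCell aShift (NPlus (NCell aRow (var vI)) (NCell aStep (var vJ)))))))"

lemma nwrites_tables [simp]: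
  "nwrites mod_prog = {aMod, vI}" "nwrites step_prog = {aStep, vI}" "nwrites row_prog = {aRow, vI}"
  "nwrites block_prog = {aBlock, vI}" "nwrites shift_prog = {aShift, vI, vJ}"
  and fwrites_tables [simp]:
  "fwrites mod_prog = {}" "fwrites step_prog = {}" "fwrites row_prog = {}"
  "fwrites block_prog = {}" "fwrites shift_prog = {}"
  by (auto simp: mod_prog_def step_prog_def row_prog_def block_prog_def shift_prog_def)

lemma runs_mod_prog:
  assumes "nats s vMod 0 = m" "nats s 0 0 = n" "m > 0" "n + 2 * m \<le> X"
  shows "runs mod_prog (1 + loop_time X (1 + 1)) s (\<lambda>s'. \<forall>k\<le>n + 2 * m. nats s' aMod k = k mod m)"
  unfolding mod_prog_def
proof (rule runs_Seq[where ?Q1.0 = "\<lambda>s'. nats s' aMod 0 = 0"], goal_cases)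
  case (2 s1)
  note [simp] = assms agree_nats[OF 2(1)]
  show ?case
  proof (rule runs_For[where I = "\<lambda>k s'. \<forall>i\<le>k. nats s' aMod i = i mod m"], goal_cases)
    case (6 k s')
    note [simp] = agree_nats[OF 6(2)]
    show ?case
      by (rule runs_If; rule runs_NAssign)
        (use 6 in \<open>auto simp: write_cell_apply mod_Suc le_Suc_eq\<close>)
  qed (use 2 in \<open>auto simp: agree_def\<close>)
qed (auto intro!: runs_NAssign simp: write_cell_apply simp del: One_nat_def)

lemma runs_step_prog:
  assumes "nats s vMod 0 = m" "nats s 0 0 = n" "m > 0" "m \<le> X"
    and aMod: "\<forall>k\<le>n + 2 * m. nats s aMod k = k mod m"
  shows "runs step_prog (1 + loop_time X 1) s (\<lambda>s'. \<forall>k\<le>m. nats s' aStep k = k * n mod m)"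
  unfolding step_prog_def
proof (rule runs_Seq[where ?Q1.0 = "\<lambda>s'. nats s' aStep 0 = 0"], goal_cases)
  case (2 s1)
  note [simp] = assms(1-4) agree_nats[OF 2(1)]
  show ?case
  proof (rule runs_For[where I = "\<lambda>k s'. \<forall>i\<le>k. nats s' aStep i = i * n mod m"], goal_cases)
    case (6 k s')
    note [simp] = agree_nats[OF 6(2)]
    have "k * n mod m + n mod m \<le> n + 2 * m"
      using pos_mod_bound[of m] assms(3) mod_less_divisor[of m "k * n"] mod_less_divisor[of m n]
      by linarith
    then have "nats s aMod (k * n mod m + n mod m) = Suc k * n mod m"
      using aMod by (simp add: mod_simps add.commute)
    then show ?case
      by (intro runs_NAssign) (use 6 aMod in \<open>auto simp: write_cell_apply le_Suc_eq\<close>)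
  qed (use 2 in \<open>auto simp: agree_def\<close>)
qed (auto intro!: runs_NAssign simp: write_cell_apply simp del: One_nat_def)

lemma runs_row_prog:
  assumes "nats s vMod 0 = m" "nats s vRows 0 = L" "L \<le> X"
  shows "runs row_prog (1 + loop_time X 1) s (\<lambda>s'. \<forall>l\<le>L. nats s' aRow l = l * m)"
  unfolding row_prog_def
proof (rule runs_Seq[where ?Q1.0 = "\<lambda>s'. nats s' aRow 0 = 0"], goal_cases)
  case (2 s1)
  note [simp] = assms agree_nats[OF 2(1)]
  show ?case
  proof (rule runs_For[where I = "\<lambda>k s'. \<forall>i\<le>k. nats s' aRow i = i * m"], goal_cases)
    case (6 k s')
    note [simp] = agree_nats[OF 6(2)]
    show ?case
      by (rule runs_NAssign) (use 6 in \<open>auto simp: write_cell_apply le_Suc_eq\<close>)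
  qed (use 2 in \<open>auto simp: agree_def\<close>)
qed (auto intro!: runs_NAssign simp: write_cell_apply simp del: One_nat_def)

lemma runs_block_prog:
  assumes "nats s 0 3 = G" "nats s vRows 0 = L" "nats s aRow L = L * m" "G \<le> X"
  shows "runs block_prog (1 + loop_time X 1) s (\<lambda>s'. \<forall>g\<le>G. nats s' aBlock g = g * (L * m))"
  unfolding block_prog_def
proof (rule runs_Seq[where ?Q1.0 = "\<lambda>s'. nats s' aBlock 0 = 0"], goal_cases)
  case (2 s1)
  note [simp] = assms agree_nats[OF 2(1)]
  show ?case
  proof (rule runs_For[where I = "\<lambda>k s'. \<forall>i\<le>k. nats s' aBlock i = i * (L * m)"], goal_cases)
    case (6 k s')
    note [simp] = agree_nats[OF 6(2)]
    show ?case
      by (rule runs_NAssign) (use 6 in \<open>auto simp: write_cell_apply le_Suc_eq\<close>)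
  qed (use 2 in \<open>auto simp: agree_def\<close>)
qed (auto intro!: runs_NAssign simp: write_cell_apply simp del: One_nat_def)

lemma row_index_eq_iff:
  fixes s s' m :: nat
  assumes "s < m" "s' < m"
  shows "l * m + s = l' * m + s' \<longleftrightarrow> l = l' \<and> s = s'"
proof
  assume eq: "l * m + s = l' * m + s'"
  have "(l * m + s) div m = l" "(l' * m + s') div m = l'" using assms by simp_all
  with eq show "l = l' \<and> s = s'" by simp
qed simp

lemma runs_shift_prog:
  assumes "nats s vMod 0 = m" "nats s vRows 0 = L" "m > 0" "m \<le> X" "L \<le> X"
    and aRow: "\<forall>l\<le>L. nats s aRow l = l * m" and aStep: "\<forall>k\<le>m. nats s aStep k = k * n mod m"
  shows "runs shift_prog (loop_time X 1 + loop_time X (loop_time X 1)) s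
    (\<lambda>s'. \<forall>l\<le>L. \<forall>k<m. nats s' aShift (l * m + k) = k * n ^ l mod m)"
  unfolding shift_prog_def
proof (rule runs_Seq[where ?Q1.0 = "\<lambda>s'. \<forall>k<m. nats s' aShift k = k"], goal_cases)
  case 1
  show ?case
    by (rule runs_For[where I = "\<lambda>k s'. \<forall>i<k. nats s' aShift i = i"])
      (use assms in \<open>auto intro!: runs_NAssign simp: write_cell_apply agree_def less_Suc_eq
        simp del: One_nat_def\<close>)
next
  case (2 s1)
  note [simp] = assms(1-5) agree_nats[OF 2(1)]
  define I where "I l s' \<longleftrightarrow> (\<forall>i\<le>l. \<forall>k<m. nats s' aShift (i * m + k) = k * n ^ i mod m)"
    for l and s' :: "'a store"
  have "runs (For vI (var vRows) (For vJ (var vMod)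
       (NAssign aShift (NPlus (NCell aRow (succ (var vI))) (var vJ))
         (NCell aShift (NPlus (NCell aRow (var vI)) (NCell aStep (var vJ)))))))
     (loop_time X (loop_time X 1)) s1 (I L)"
  proof (rule runs_For[where N = L and I = I], goal_cases)
    case (6 l s2)
    note [simp] = agree_nats[OF 6(2)]
    show ?case
    proof (rule runs_conseq, rule runs_For[where N = m and
          I = "\<lambda>j s'. I l s' \<and> (\<forall>k<j. nats s' aShift (Suc l * m + k) = k * n ^ Suc l mod m)"], goal_cases)
      case (6 j s3)
      note [simp] = agree_nats[OF 6(2)]
      have "nats s3 aShift (l * m + j * n mod m) = (j * n mod m) * n ^ l mod m"
        using 6(4) \<open>m > 0\<close> by (simp add: I_def)
      also have "\<dots> = j * n ^ Suc l mod m"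
        by (simp add: mod_mult_left_eq mult.assoc)
      finally have "nats s3 aShift (l * m + j * n mod m) = j * n ^ Suc l mod m" .
      \<comment> \<open>Writing row \<open>Suc l\<close> leaves the rows up to \<open>l\<close>
        intact, on which the invariant and the copying depend.\<close>
      moreover have "i * m + k \<noteq> Suc l * m + j" if "i \<le> l" "k < m" for i k
        using row_index_eq_iff[of k m j i "Suc l"] that 6(1) by auto
      ultimately show ?case
        using \<open>l < L\<close> \<open>nats s2 vI 0 = l\<close> aRow[rule_format, of l] aRow[rule_format, of "Suc l"]
          aStep[rule_format, of j] 6
        by (intro runs_NAssign) (auto simp: write_cell_apply less_Suc_eq I_def simp del: mult_Suc)
    next
      case (8 s3)
      then show ?case by (auto simp: I_def le_Suc_eq simp del: mult_Suc)
    qed (use 6 in \<open>auto simp: agree_def I_def\<close>)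
  qed (use 2 in \<open>auto simp: agree_def I_def\<close>)
  then show ?case unfolding I_def .
qed


definition table_prog :: com where
  "table_prog = Seq mod_prog (Seq step_prog (Seq row_prog (Seq block_prog shift_prog)))"

definition table_time :: "nat \<Rightarrow> nat" where
  "table_time X = (1 + loop_time X (1 + 1)) + ((1 + loop_time X 1) + ((1 + loop_time X 1)
     + ((1 + loop_time X 1) + (loop_time X 1 + loop_time X (loop_time X 1)))))"

text \<open>What the evaluation of gates relies on; \<open>aStep\<close> has done its work once
  \<open>aShift\<close> is filled.\<close>

definition tables :: "nat \<Rightarrow> nat \<Rightarrow> nat \<Rightarrow> nat \<Rightarrow> 'a store \<Rightarrow> bool" where
  "tables n L G m s \<longleftrightarrow> nats s 0 0 = n \<and> nats s 0 3 = G \<and> nats s vRows 0 = L \<and> nats s vMod 0 = m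
     \<and> (\<forall>k\<le>n + 2 * m. nats s aMod k = k mod m) \<and> (\<forall>l\<le>L. nats s aRow l = l * m)
     \<and> (\<forall>g\<le>G. nats s aBlock g = g * (L * m))
     \<and> (\<forall>l\<le>L. \<forall>k<m. nats s aShift (l * m + k) = k * n ^ l mod m)"

lemma tables_agree:
  "tables n L G m s \<Longrightarrow> agree A B s s' \<Longrightarrow> {0, vRows, vMod, aMod, aRow, aBlock, aShift} \<inter> A = {} \<Longrightarrow>
   tables n L G m s'"
  by (simp add: tables_def agree_def)

lemma nwrites_table_prog [simp]: "nwrites table_prog = {aMod, aStep, aRow, aBlock, aShift, vI, vJ}"
  and fwrites_table_prog [simp]: "fwrites table_prog = {}"
  by (auto simp: table_prog_def)

lemma runs_table_prog:
  assumes "nats s 0 0 = n" "nats s 0 3 = G" "nats s vRows 0 = L" "nats s vMod 0 = m" "m > 0"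
    and X: "n + 2 * m \<le> X" "L \<le> X" "G \<le> X"
  shows "runs table_prog (table_time X) s (tables n L G m)"
proof -
  have X': "m \<le> X" using X by simp
  show ?thesis
    unfolding table_prog_def table_time_def
  proof (rule runs_Seq, rule runs_mod_prog[where n = n and m = m], goal_cases)
    case (5 s1)
    note [simp] = assms agree_nats[OF 5(1)]
    show ?case
    proof (rule runs_Seq, rule runs_step_prog[where n = n and m = m], goal_cases)
      case (6 s2)
      note [simp] = agree_nats[OF 6(1)]
      show ?case
      proof (rule runs_Seq, rule runs_row_prog[where L = L and m = m], goal_cases)
        case (4 s3)
        note [simp] = agree_nats[OF 4(1)]
        show ?case
        proof (rule runs_Seq, rule runs_block_prog[where G = G and L = L and m = m], goal_cases)
          case (5 s4)
          note [simp] = agree_nats[OF 5(1)]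
          show ?case
          proof (rule runs_conseq,
              rule runs_shift_prog[where m = m and L = L and n = n], goal_cases)
            case (8 s5)
            note [simp] = agree_nats[OF 8(1)]
            show ?case
              using 8(2) \<open>\<forall>k\<le>n + 2 * m. nats s1 aMod k = k mod m\<close>
                \<open>\<forall>l\<le>L. nats s3 aRow l = l * m\<close> \<open>\<forall>g\<le>G. nats s4 aBlock g = g * (L * m)\<close>
              by (simp add: tables_def)
          qed (use X X' 6 4 in \<open>simp_all\<close>)
        qed (use X X' 4 in \<open>simp_all\<close>)
      qed (use X X' in \<open>simp_all\<close>)
    qed (use X X' 5 in \<open>simp_all\<close>)
  qed (use assms in \<open>simp_all\<close>)
qed

section \<open>Operations on coefficient tables\<close>

abbreviation (input) "eRows \<equiv> NCell aRow (var vRows)"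
abbreviation (input) "eLeft e \<equiv> FCell fVal (NPlus (NCell aBlock (NCell aLeft (var vGate))) e)"
abbreviation (input) "eRight e \<equiv> FCell fVal (NPlus (NCell aBlock (NCell aRight (var vGate))) e)"
abbreviation (input) "eTarget \<equiv> NPlus (NCell aRow (NPlus (var vL1) (var vL2)))
  (NCell aMod (NPlus (NCell aShift (NPlus (NCell aRow (var vL2)) (var vS1))) (var vS2)))"

definition clear_prog :: com where
  "clear_prog = For vI eRows (FAssign fAcc (var vI) FZero)"

definition add_prog :: com where
  "add_prog = For vI eRows (FAssign fAcc (var vI) (FPlus (eLeft (var vI)) (eRight (var vI))))"

text \<open>The loops follow the four sums of \<open>table_mult\<close>; the target cell is looked
  up in the index tables.\<close>

definition mul_prog :: com where
  "mul_prog = For vL1 (var vRows) (For vL2 (NMinus (var vRows) (var vL1))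
     (For vS1 (var vMod) (For vS2 (var vMod)
       (FAssign fAcc eTarget (FPlus (FCell fAcc eTarget)
         (FTimes (eLeft (NPlus (NCell aRow (var vL1)) (var vS1)))
                 (eRight (NPlus (NCell aRow (var vL2)) (var vS2)))))))))"

definition copy_prog :: com where
  "copy_prog = For vI eRows
     (FAssign fVal (NPlus (NCell aBlock (var vGate)) (var vI)) (FCell fAcc (var vI)))"

lemma nwrites_gate_progs [simp]:
  "nwrites clear_prog = {vI}" "nwrites add_prog = {vI}"
  "nwrites mul_prog = {vL1, vL2, vS1, vS2}" "nwrites copy_prog = {vI}"
  and fwrites_gate_progs [simp]:
  "fwrites clear_prog = {fAcc}" "fwrites add_prog = {fAcc}"
  "fwrites mul_prog = {fAcc}" "fwrites copy_prog = {fVal}"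
  by (auto simp: clear_prog_def add_prog_def mul_prog_def copy_prog_def)

lemma runs_clear_prog:
  assumes "tables n L G m s" "L * m \<le> X"
  shows "runs clear_prog (loop_time X 1) s (\<lambda>s'. \<forall>j<L * m. flds s' fAcc j = 0)"
  unfolding clear_prog_def
  by (rule runs_For[where I = "\<lambda>k s'. \<forall>j<k. flds s' fAcc j = 0"])
    (use assms in \<open>auto intro!: runs_FAssign simp: tables_def write_cell_apply agree_def less_Suc_eq
      simp del: One_nat_def\<close>)

lemma runs_add_prog:
  assumes "tables n L G m s" "L * m \<le> X"
    and g: "nats s vGate 0 = g" "nats s aLeft g = l" "nats s aRight g = r" "l < G" "r < G"
  shows "runs add_prog (loop_time X 1) s
    (\<lambda>s'. \<forall>j<L * m. flds s' fAcc j = flds s fVal (l * (L * m) + j) + flds s fVal (r * (L * m) + j))"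
  unfolding add_prog_def
proof (rule runs_For[where I = "\<lambda>k s'. \<forall>j<k. flds s' fAcc j
      = flds s fVal (l * (L * m) + j) + flds s fVal (r * (L * m) + j)"], goal_cases)
  case (6 k s')
  note [simp] = agree_nats[OF 6(2)] agree_flds[OF 6(2)]
  show ?case
    by (rule runs_FAssign)
      (use assms 6 in \<open>auto simp: tables_def write_cell_apply less_Suc_eq\<close>)
qed (use assms in \<open>auto simp: tables_def agree_def\<close>)

text \<open>The postcondition covers every cell of \<open>fVal\<close>, since the blocks of earlier
  gates must be known to survive.\<close>

lemma runs_copy_prog:
  assumes "tables n L G m s" "L * m \<le> X" "nats s vGate 0 = g" "g < G"
  shows "runs copy_prog (loop_time X 1) s
    (\<lambda>s'. \<forall>x. flds s' fVal x = (if g * (L * m) \<le> x \<and> x < g * (L * m) + L * m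
       then flds s fAcc (x - g * (L * m)) else flds s fVal x))"
  unfolding copy_prog_def
proof (rule runs_For[where I = "\<lambda>k s'. \<forall>x. flds s' fVal x =
      (if g * (L * m) \<le> x \<and> x < g * (L * m) + k
       then flds s fAcc (x - g * (L * m)) else flds s fVal x)"], goal_cases)
  case (6 k s')
  note [simp] = agree_nats[OF 6(2)] agree_flds[OF 6(2)]
  show ?case
    by (rule runs_FAssign)
      (use assms 6 in \<open>auto simp: tables_def write_cell_apply less_Suc_eq\<close>)
qed (use assms in \<open>auto simp: tables_def agree_def\<close>)

definition mul_time :: "nat \<Rightarrow> nat" where
  "mul_time X = loop_time X (loop_time X (loop_time X (loop_time X 1)))"

lemma runs_mul_prog:
  fixes s :: "'a::field store"
  assumes tab: "tables n L G m s" and X: "L \<le> X" "m \<le> X"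
    and g: "nats s vGate 0 = g" "nats s aLeft g = l" "nats s aRight g = r" "l < G" "r < G"
  shows "runs mul_prog (mul_time X) s (\<lambda>s'. \<forall>j. flds s' fAcc j = flds s fAcc j +
    (\<Sum>l1<L. \<Sum>l2<L - l1. \<Sum>s1<m. \<Sum>s2<m.
       if j = (l1 + l2) * m + (s1 * n ^ l2 + s2) mod m
       then flds s fVal (l * (L * m) + (l1 * m + s1)) * flds s fVal (r * (L * m) + (l2 * m + s2))
       else 0))"
  unfolding mul_prog_def mul_time_def
proof (rule runs_For_accumulate, goal_cases)
  case (5 l1 s1)
  note A1 = agree_nats[OF 5(2)] agree_flds[OF 5(2)]
  show ?case
  proof (rule runs_For_accumulate, goal_cases)
    case (5 l2 s2)
    note A2 = agree_nats[OF 5(2)] agree_flds[OF 5(2)]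
    show ?case
    proof (rule runs_For_accumulate, goal_cases)
      case (5 k1 s3)
      note A3 = agree_nats[OF 5(2)] agree_flds[OF 5(2)]
      show ?case
      proof (rule runs_For_accumulate, goal_cases)
        case (5 k2 s4)
        note [simp] = A1 A2 A3 agree_nats[OF 5(2)] agree_flds[OF 5(2)]
          \<open>nats s1 vL1 0 = l1\<close> \<open>nats s2 vL2 0 = l2\<close> \<open>nats s3 vS1 0 = k1\<close> \<open>nats s4 vS2 0 = k2\<close> g
        have b: "k1 < m" "k2 < m" "l1 + l2 \<le> L" "l1 \<le> L" "l2 \<le> L" "l \<le> G" "r \<le> G"
          using \<open>k1 < m\<close> \<open>k2 < m\<close> \<open>l1 < L\<close> \<open>l2 < L - l1\<close>
            less_imp_le[OF g(4)] less_imp_le[OF g(5)] by simp_all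
        have "k1 * n ^ l2 mod m < m" using b by simp
        then have le: "k1 * n ^ l2 mod m + k2 \<le> n + 2 * m" using b by linarith
        have [simp]: "nats s aRow l1 = l1 * m" "nats s aRow l2 = l2 * m" "nats s aRow (l1 + l2) = (l1 + l2) * m"
          "nats s aBlock l = l * (L * m)" "nats s aBlock r = r * (L * m)"
          "nats s aShift (l2 * m + k1) = k1 * n ^ l2 mod m"
          "nats s aMod (k1 * n ^ l2 mod m + k2) = (k1 * n ^ l2 + k2) mod m"
          using tab b le by (simp_all add: tables_def mod_add_left_eq)
        show ?case
          by (rule runs_FAssign) (auto simp: write_cell_apply)
      qed (use tab X in \<open>auto simp: A1 A2 A3 tables_def\<close>)
    qed (use tab X in \<open>auto simp: A1 A2 tables_def\<close>)
  qed (use tab X 5 in \<open>auto simp: A1 tables_def\<close>)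
qed (use tab X in \<open>auto simp: tables_def\<close>)

section \<open>Evaluating the gates\<close>

definition input_prog :: com where
  "input_prog = FAssign fAcc (NPlus (NCell aRow (NNum 1)) (NCell aMod (NCell aLeft (var vGate)))) FOne"

definition scalar_prog :: com where
  "scalar_prog = FAssign fAcc (NNum 0) (FCell fScalar (var vGate))"

definition op_prog :: com where
  "op_prog = If (NEq (NCell aOp (var vGate)) (NNum 0)) input_prog
     (If (NEq (NCell aOp (var vGate)) (NNum 1)) scalar_prog
     (If (NEq (NCell aOp (var vGate)) (NNum 2)) add_prog mul_prog))"

text \<open>Results pass through \<open>fAcc\<close>, so that the frame by whole arrays keeps
  \<open>fVal\<close> fixed while the operands are read.\<close>

definition gate_prog :: com where
  "gate_prog = Seq clear_prog (Seq op_prog copy_prog)"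

text \<open>The last three ones pay for the nested tests; the sum before them dominates every
  branch.\<close>

definition op_time :: "nat \<Rightarrow> nat" where
  "op_time X = 1 + loop_time X 1 + mul_time X + 1 + 1 + 1"

definition gate_time :: "nat \<Rightarrow> nat" where
  "gate_time X = loop_time X 1 + (op_time X + loop_time X 1)"

lemma nwrites_gate_prog [simp]: "nwrites gate_prog = {vI, vL1, vL2, vS1, vS2}"
  and fwrites_gate_prog [simp]: "fwrites gate_prog = {fVal, fAcc}"
  by (auto simp: gate_prog_def op_prog_def input_prog_def scalar_prog_def)

definition loaded :: "'a::field circuit \<Rightarrow> 'a store \<Rightarrow> bool" where
  "loaded C s \<longleftrightarrow> nats s aOp = array_of (map opcode C) \<and> nats s aLeft = array_of (map operand1 C)
     \<and> nats s aRight = array_of (map operand2 C) \<and> flds s fScalar = array_of (map scalar C)"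

lemma loaded_agree:
  "loaded C s \<Longrightarrow> agree A B s s' \<Longrightarrow> {aOp, aLeft, aRight} \<inter> A = {} \<Longrightarrow> fScalar \<notin> B \<Longrightarrow> loaded C s'"
  by (simp add: loaded_def agree_def)

lemma array_of_map: "i < length xs \<Longrightarrow> array_of (map f xs) i = f (xs ! i)"
  by (simp add: array_of_def)

definition evaluated :: "nat \<Rightarrow> nat \<Rightarrow> nat \<Rightarrow> 'a::field circuit \<Rightarrow> nat \<Rightarrow> 'a store \<Rightarrow> bool" where
  "evaluated n L m C g s \<longleftrightarrow>
     (\<forall>i<g. \<forall>j<L * m. flds s fVal (i * (L * m) + j) = table n m (gate_vals C ! i) j)"

text \<open>The accumulator has to start at zero: input and scalar gates write a single cell, and
  multiplication adds to what it finds.\<close>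

lemma runs_op_prog:
  assumes tab: "tables n L (length C) m s" and load: "loaded C s" and ev: "evaluated n L m C g s"
    and acc: "\<forall>j<L * m. flds s fAcc j = 0" and g: "nats s vGate 0 = g" "g < length C"
    and wf: "\<forall>k<length C. wf_gate n k (C ! k)"
    and "L > 0" and X: "L * m \<le> X" "L \<le> X" "m \<le> X"
  shows "runs op_prog (op_time X) s (\<lambda>s'. \<forall>j<L * m. flds s' fAcc j = table n m (gate_vals C ! g) j)"
proof -
  note val = gate_vals_nth[OF wf g(2)]
  have wfg: "wf_gate n g (C ! g)" using wf g by simp
  have op: "nats s aOp g = opcode (C ! g)" "nats s aLeft g = operand1 (C ! g)"
    "nats s aRight g = operand2 (C ! g)" "flds s fScalar g = scalar (C ! g)"
    using load g by (simp_all add: loaded_def array_of_map)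
  have val_at: "flds s fVal (i * (L * m) + j) = table n m (gate_vals C ! i) j"
    if "i < g" "j < L * m" for i j
    using ev that by (simp add: evaluated_def)
  let ?T = "1 + loop_time X 1 + mul_time X"
  let ?Q = "\<lambda>s'. \<forall>j<L * m. flds s' fAcc j = table n m (gate_vals C ! g) j"
  have input: "runs input_prog (?T + 1 + 1) s ?Q" if "opcode (C ! g) = 0"
  proof -
    from that obtain x where x: "C ! g = Input x" by (cases "C ! g") auto
    with wfg have "x \<le> n + 2 * m" by simp
    then have "nats s aRow 1 = m" "nats s aMod x = x mod m"
      using tab \<open>L > 0\<close> by (simp_all add: tables_def)
    then have "runs input_prog 1 s ?Q"
      unfolding input_prog_def
      by (intro runs_FAssign) (use acc x op g val in \<open>auto simp: write_cell_apply table_var\<close>)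
    then show ?thesis by (rule runs_mono) simp_all
  qed
  have scalar: "runs scalar_prog (?T + 1) s ?Q" if "opcode (C ! g) = 1"
  proof -
    from that obtain a where a: "C ! g = Scalar a" by (cases "C ! g") auto
    then have "runs scalar_prog 1 s ?Q"
      unfolding scalar_prog_def
      by (intro runs_FAssign) (use acc op g val in \<open>auto simp: write_cell_apply table_const\<close>)
    then show ?thesis by (rule runs_mono) simp_all
  qed
  have add: "runs add_prog ?T s ?Q" if "opcode (C ! g) = 2"
  proof -
    from that obtain l r where lr: "C ! g = Add l r" by (cases "C ! g") auto
    with wfg have lrg: "l < g" "r < g" by simp_all
    show ?thesis
      by (rule runs_mono, rule runs_add_prog[OF tab X(1) g(1), where l = l and r = r])
        (use op lr lrg less_trans[OF _ g(2)] val val_at[unfolded One_nat_def] in \<open>simp_all add: table_add\<close>)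
  qed
  have mul: "runs mul_prog ?T s ?Q"
    if "opcode (C ! g) \<noteq> 0" "opcode (C ! g) \<noteq> 1" "opcode (C ! g) \<noteq> 2"
  proof -
    from that obtain l r where lr: "C ! g = Mul l r" by (cases "C ! g") auto
    with wfg have lrg: "l < g" "r < g" by simp_all
    \<comment> \<open>Offsets in rows below \<open>L\<close> stay inside a block, so
      \<open>val_at\<close> applies to both operands.\<close>
    have less: "i * m + k < L * m" if "i < L" "k < m" for i k
    proof -
      have "Suc i * m \<le> L * m" using that by (intro mult_le_mono1) simp
      then show ?thesis using that by simp
    qed
    have sum_eq: "(\<Sum>l1<L. \<Sum>l2<L - l1. \<Sum>s1<m. \<Sum>s2<m.
       if j = (l1 + l2) * m + (s1 * n ^ l2 + s2) mod m
       then flds s fVal (l * (L * m) + (l1 * m + s1)) * flds s fVal (r * (L * m) + (l2 * m + s2))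
       else 0) = table n m (gate_vals C ! g) j" if "j < L * m" for j
      unfolding val lr gate_poly.simps table_mult[OF that] mult_cell_def
      by (intro sum.cong refl) (simp add: val_at[unfolded One_nat_def] lrg less)
    show ?thesis
      by (rule runs_mono, rule runs_mul_prog[OF tab X(2,3) g(1), where l = l and r = r])
        (use op lr lrg g acc in \<open>auto simp: sum_eq\<close>)
  qed
  note op' = op[unfolded One_nat_def]
  show ?thesis
    unfolding op_prog_def op_time_def
    by (rule runs_If, rule input, simp add: op' g, rule runs_If, rule scalar, simp add: op' g,
        rule runs_If, rule add, simp add: op' g, rule mul) (simp_all add: op' g)
qed

lemma runs_gate_prog:
  assumes tab: "tables n L (length C) m s" and load: "loaded C s" and ev: "evaluated n L m C g s"
    and g: "nats s vGate 0 = g" "g < length C"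
    and wf: "\<forall>k<length C. wf_gate n k (C ! k)"
    and L: "L > 0" and X: "L * m \<le> X" "L \<le> X" "m \<le> X"
  shows "runs gate_prog (gate_time X) s (evaluated n L m C (Suc g))"
  unfolding gate_prog_def gate_time_def
proof (rule runs_Seq, rule runs_clear_prog[OF tab X(1)], goal_cases)
  case (1 s1)
  note [simp] = agree_nats[OF 1(1)] agree_flds[OF 1(1)]
  have tab1: "tables n L (length C) m s1" by (rule tables_agree[OF tab 1(1)]) simp
  have load1: "loaded C s1" by (rule loaded_agree[OF load 1(1)]) simp_all
  have ev1: "evaluated n L m C g s1" using ev by (simp add: evaluated_def)
  have g1: "nats s1 vGate 0 = g" using g by simp
  show ?case
  proof (rule runs_Seq, rule runs_op_prog[OF tab1 load1 ev1 1(2) g1 g(2) wf L X], goal_cases)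
    case (1 s2)
    have A: "agree {vI, vL1, vL2, vS1, vS2} {fAcc} s1 s2"
      by (rule agree_mono[OF 1(1)]) (auto simp: op_prog_def input_prog_def scalar_prog_def)
    have tab2: "tables n L (length C) m s2" by (rule tables_agree[OF tab1 A]) simp
    have g2: "nats s2 vGate 0 = g" using g agree_nats[OF A] by simp
    show ?case
    proof (rule runs_mono[OF runs_copy_prog[OF tab2 X(1) g2 g(2)] order_refl], goal_cases)
      case (1 s3)
      have "flds s3 fVal (i * (L * m) + j) = table n m (gate_vals C ! i) j"
        if "i < Suc g" "j < L * m" for i j
      proof (cases "i = g")
        case True
        then show ?thesis
          using 1 that \<open>\<forall>j<L * m. flds s2 fAcc j = table n m (gate_vals C ! g) j\<close> by simp
      next
        case False
        \<comment> \<open>Blocks of earlier gates end at or before \<open>g * (L * m)\<close>, where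
          the copied range begins.\<close>
        with that have "Suc i * (L * m) \<le> g * (L * m)" by (intro mult_le_mono1) simp
        then have "i * (L * m) + j < g * (L * m)" using that by simp
        then show ?thesis
          using 1 False that ev1 agree_flds[OF A, of fVal] by (simp add: evaluated_def)
      qed
      then show ?case by (simp add: evaluated_def)
    qed
  qed
qed

section \<open>One round for a fixed modulus\<close>

definition eval_prog :: com where
  "eval_prog = For vGate eGates gate_prog"

text \<open>The flag \<open>vRes\<close> is only ever lowered, so after several rounds it tells
  whether all of them found the output table zero.\<close>

definition check_prog :: com where
  "check_prog = For vI eRows
     (If (FEq (FCell fVal (NPlus (NCell aBlock (NMinus eGates (NNum 1))) (var vI))) FZero)
       Skip (NAssign vRes (NNum 0) (NNum 0)))"

definition round_prog :: com where
  "round_prog = Seq table_prog (Seq eval_prog check_prog)"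

definition round_time :: "nat \<Rightarrow> nat" where
  "round_time X = table_time X + (loop_time X (gate_time X) + loop_time X (1 + 1))"

lemma nwrites_eval_prog [simp]: "nwrites eval_prog = {vGate, vI, vL1, vL2, vS1, vS2}"
  and fwrites_eval_prog [simp]: "fwrites eval_prog = {fVal, fAcc}"
  and nwrites_check_prog [simp]: "nwrites check_prog = {vI, vRes}"
  and fwrites_check_prog [simp]: "fwrites check_prog = {}"
  and nwrites_round_prog [simp]: "nwrites round_prog =
    {aMod, aStep, aRow, aBlock, aShift, vI, vJ, vGate, vL1, vL2, vS1, vS2, vRes}"
  and fwrites_round_prog [simp]: "fwrites round_prog = {fVal, fAcc}"
  by (auto simp: eval_prog_def check_prog_def round_prog_def)

lemma runs_eval_prog:
  assumes tab: "tables n L (length C) m s" and load: "loaded C s"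
    and wf: "\<forall>k<length C. wf_gate n k (C ! k)"
    and "L > 0" and X: "L * m \<le> X" "L \<le> X" "m \<le> X" "length C \<le> X"
  shows "runs eval_prog (loop_time X (gate_time X)) s (evaluated n L m C (length C))"
  unfolding eval_prog_def
proof (rule runs_For[where I = "evaluated n L m C"], goal_cases)
  case (6 g s1)
  show ?case
    using 6 assms
    by (intro runs_gate_prog) (auto intro: tables_agree[OF tab] loaded_agree[OF load])
qed (use tab X in \<open>auto simp: evaluated_def tables_def agree_def\<close>)

lemma runs_check_prog:
  assumes tab: "tables n L (length C) m s" and ev: "evaluated n L m C (length C) s"
    and C: "C \<noteq> []" and X: "L * m \<le> X"
  shows "runs check_prog (loop_time X (1 + 1)) s
    (\<lambda>s'. nats s' vRes 0 = (if nonvanishing n L m (circuit_poly C) then 0 else nats s vRes 0))"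
proof -
  have val: "flds s fVal ((length C - 1) * (L * m) + j) = table n m (circuit_poly C) j"
    if "j < L * m" for j
    using ev C that by (simp add: evaluated_def circuit_poly_nth)
  have "runs check_prog (loop_time X (1 + 1)) s
    (\<lambda>s'. nats s' vRes 0 = (if \<exists>j<L * m. table n m (circuit_poly C) j \<noteq> 0 then 0 else nats s vRes 0))"
    unfolding check_prog_def
  proof (rule runs_For[where I = "\<lambda>k s'. nats s' vRes 0 =
      (if \<exists>j<k. table n m (circuit_poly C) j \<noteq> 0 then 0 else nats s vRes 0)"], goal_cases)
    case (6 k s1)
    note [simp] = agree_nats[OF 6(2)] agree_flds[OF 6(2)]
    have "flds s1 fVal (nats s1 aBlock (nats s1 0 3 - 1) + k) = table n m (circuit_poly C) k"
      using val[OF 6(1)] tab by (simp add: tables_def)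
    then show ?case
      using 6(3,4) by (intro runs_If runs_Skip runs_NAssign) (auto simp: write_cell_apply less_Suc_eq)
  qed (use tab X in \<open>auto simp: tables_def agree_def\<close>)
  then show ?thesis unfolding nonvanishing_def .
qed

text \<open>A round rebuilds its index tables and gate blocks from scratch, which lets one set of
  arrays serve all moduli.\<close>

lemma runs_round_prog:
  assumes s: "nats s 0 0 = n" "nats s 0 3 = length C" "nats s vRows 0 = L" "nats s vMod 0 = m"
    and load: "loaded C s" and wf: "wf_circuit n C"
    and pos: "L > 0" "m > 0" and X: "L * m \<le> X" "L \<le> X" "n + 2 * m \<le> X" "length C \<le> X"
  shows "runs round_prog (round_time X) s
    (\<lambda>s'. nats s' vRes 0 = (if nonvanishing n L m (circuit_poly C) then 0 else nats s vRes 0))"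
proof -
  from wf have wf': "\<forall>k<length C. wf_gate n k (C ! k)" and C: "C \<noteq> []"
    by (auto simp: wf_circuit_def)
  have m: "m \<le> X" using X by simp
  show ?thesis
    unfolding round_prog_def round_time_def
  proof (rule runs_Seq, rule runs_table_prog[OF s pos(2) X(3,2,4)], goal_cases)
    case (1 s1)
    have load1: "loaded C s1" by (rule loaded_agree[OF load 1(1)]) simp_all
    have res1: "nats s1 vRes 0 = nats s vRes 0" using agree_nats[OF 1(1)] by simp
    show ?case
    proof (rule runs_Seq, rule runs_eval_prog[OF 1(2) load1 wf' pos(1) X(1,2) m X(4)], goal_cases)
      case (1 s2)
      have tab2: "tables n L (length C) m s2"
        by (rule tables_agree[OF \<open>tables n L (length C) m s1\<close> 1(1)]) simp
      have res2: "nats s2 vRes 0 = nats s vRes 0" using agree_nats[OF 1(1)] res1 by simp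
      show ?case using runs_check_prog[OF tab2 1(2) C X(1)] unfolding res2 .
    qed
  qed
qed

section \<open>The complete test\<close>

text \<open>The bound \<open>n * d * t + 2\<close> is formed by repeated addition. The verdict is
  moved to cell 0 of array 0 only at the end, because that cell holds \<open>n\<close> until
  then.\<close>

definition zero_test :: com where
  "zero_test =
     Seq (For vI eDeg (NAssign vProd (NNum 0) (NPlus (var vProd) eVars)))
    (Seq (NAssign vBound (NNum 0) (NNum 2))
    (Seq (For vI eMonos (NAssign vBound (NNum 0) (NPlus (var vBound) (var vProd))))
    (Seq (NAssign vRows (NNum 0) (NPlus eDeg (NNum 2)))
    (Seq (NAssign vRes (NNum 0) (NNum 1))
    (Seq (For vK (var vBound) (Seq (NAssign vMod (NNum 0) (succ (var vK))) round_prog))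
         (NAssign 0 (NNum 0) (var vRes)))))))"

definition zero_test_time :: "nat \<Rightarrow> nat" where
  "zero_test_time X = loop_time X 1 + (1 + (loop_time X 1 + (1 + (1
     + (loop_time X (1 + round_time X) + 1)))))"

lemma runs_zero_test:
  fixes C :: "'a::field circuit"
  assumes promise: "promise n d t C"
    and X: "(d + 2) * (n * d * t + 2) \<le> X" "n + 2 * (n * d * t + 2) \<le> X" "t \<le> X" "length C \<le> X"
  shows "runs zero_test (zero_test_time X) (input_store n d t C)
    (\<lambda>s'. nats s' 0 0 = (if circuit_poly C = 0 then 1 else 0))"
proof -
  let ?s = "input_store n d t C :: 'a store" and ?M = "n * d * t + 2"
  \<comment> \<open>The second factor is positive, so the first assumption on \<open>X\<close> also
    bounds the number of rows.\<close>
  have "(d + 2) * 1 \<le> (d + 2) * ?M" by (intro mult_le_mono2) simp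
  then have d: "d + 2 \<le> X" using X by simp
  from promise have wf: "wf_circuit n C" by (simp add: promise_def)
  have load: "loaded C ?s" by (simp add: loaded_def input_store_def)
  have in0: "nats ?s 0 0 = n" "nats ?s 0 (Suc 0) = d" "nats ?s 0 2 = t" "nats ?s 0 3 = length C"
    "nats ?s vProd 0 = 0"
    by (simp_all add: input_store_def array_of_def nth_Cons')
  have keys: "Poly_Mapping.keys (circuit_poly C) \<subseteq> words_over n"
    using wf gate_vals_words_over[of C n "length C - 1"]
    by (auto simp: wf_circuit_def circuit_poly_nth)
  have zero_iff: "circuit_poly C = 0 \<longleftrightarrow> (\<forall>k<?M. \<not> nonvanishing n (d + 2) (Suc k) (circuit_poly C))"
    by (rule zero_iff_vanishing[OF keys]) (use promise in \<open>simp_all add: promise_def\<close>)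
  show ?thesis
    unfolding zero_test_def zero_test_time_def
  proof (rule runs_Seq[where ?Q1.0 = "\<lambda>s. nats s vProd 0 = n * d"], goal_cases)
    case 1
    show ?case
      by (rule runs_For[where N = d and I = "\<lambda>k s. nats s vProd 0 = n * k"])
        (use in0 in0(2)[folded One_nat_def] d in \<open>auto intro!: runs_NAssign simp: agree_def write_cell_apply simp del: One_nat_def\<close>)
  next
    case (2 s1)
    note [simp] = in0 in0(2)[folded One_nat_def] agree_nats[OF 2(1)] agree_flds[OF 2(1)]
    show ?case
    proof (rule runs_Seq[where ?Q1.0 = "\<lambda>s. nats s vBound 0 = 2"], goal_cases)
      case (2 s2)
      note [simp] = agree_nats[OF 2(1)] agree_flds[OF 2(1)]
      show ?case
      proof (rule runs_Seq[where ?Q1.0 = "\<lambda>s. nats s vBound 0 = ?M"], goal_cases)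
        case 1
        show ?case
        proof (rule runs_mono[OF runs_For[where N = t and
              I = "\<lambda>k s. nats s vBound 0 = n * d * k + 2"] order_refl], goal_cases)
          case (6 k s)
          then show ?case
            using agree_nats[OF 6(2)] \<open>nats s1 vProd 0 = n * d\<close>
            by (intro runs_NAssign) (simp add: write_cell_apply)
        qed (use 2 X in \<open>auto simp: agree_def\<close>)
      next
        case (2 s3)
        note [simp] = agree_nats[OF 2(1)] agree_flds[OF 2(1)] \<open>nats s3 vBound 0 = ?M\<close>
        show ?case
        proof (rule runs_Seq[where ?Q1.0 = "\<lambda>s. nats s vRows 0 = d + 2"], goal_cases)
          case (2 s4)
          note [simp] = agree_nats[OF 2(1)] agree_flds[OF 2(1)] \<open>nats s4 vRows 0 = d + 2\<close>
          show ?case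
          proof (rule runs_Seq[where ?Q1.0 = "\<lambda>s. nats s vRes 0 = 1"], goal_cases)
            case (2 s5)
            note [simp] = agree_nats[OF 2(1)] agree_flds[OF 2(1)] \<open>nats s5 vRes 0 = 1\<close>
            let ?I = "\<lambda>k s. nats s vRes 0 =
              (if \<exists>i<k. nonvanishing n (d + 2) (Suc i) (circuit_poly C) then 0 else 1)"
            show ?case
            proof (rule runs_Seq[where ?Q1.0 = "?I ?M"], goal_cases)
              case 1
              show ?case
              proof (rule runs_For[where I = ?I], goal_cases)
                case (4)
                show ?case using X(2) by simp
              next
                case (6 k s6)
                note [simp] = agree_nats[OF 6(2)] agree_flds[OF 6(2)]
                show ?case
                proof (rule runs_Seq[where ?Q1.0 = "\<lambda>s. nats s vMod 0 = Suc k"], goal_cases)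
                  case 1
                  show ?case
                    by (rule runs_NAssign) (use 6 in \<open>simp add: write_cell_apply\<close>)
                next
                  case (2 s7)
                  note [simp] = agree_nats[OF 2(1)] agree_flds[OF 2(1)]
                  have le: "Suc k \<le> ?M" using 6 by simp
                  have X': "(d + 2) * Suc k \<le> X" "n + 2 * Suc k \<le> X"
                    by (rule le_trans[OF mult_le_mono2[OF le] X(1)],
                        rule le_trans[OF add_left_mono[OF mult_le_mono2[OF le]] X(2)])
                  have "loaded C s7" using load by (simp add: loaded_def)
                  then have "runs round_prog (round_time X) s7 (\<lambda>s'. nats s' vRes 0 =
                    (if nonvanishing n (d + 2) (Suc k) (circuit_poly C) then 0 else nats s7 vRes 0))"
                    using wf X' X(4) d 2(2) by (intro runs_round_prog) simp_all
                  then show ?case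
                    by (rule runs_mono) (use 6 in \<open>auto simp: less_Suc_eq\<close>)
                qed
              qed (auto simp: agree_def)
            next
              case (2 s6)
              then show ?case
                by (intro runs_NAssign) (simp add: write_cell_apply zero_iff)
            qed
          qed (auto intro!: runs_NAssign simp: write_cell_apply simp del: One_nat_def)
        qed (auto intro!: runs_NAssign simp: write_cell_apply simp del: One_nat_def)
      qed
    qed (auto intro!: runs_NAssign simp: write_cell_apply simp del: One_nat_def)
  qed
qed

section \<open>Polynomial running time\<close>

text \<open>From 1 on a larger exponent gives a larger power, so a sum of two such bounds is again
  below a single monomial.\<close>

definition poly_bounded :: "(nat \<Rightarrow> nat) \<Rightarrow> bool" where
  "poly_bounded f \<longleftrightarrow> (\<exists>c k. \<forall>x\<ge>1. f x \<le> c * x ^ k)"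

lemma poly_bounded_const: "poly_bounded (\<lambda>x. a)"
  unfolding poly_bounded_def by (intro exI[of _ a] exI[of _ 0]) simp

lemma poly_bounded_id: "poly_bounded (\<lambda>x. x)"
  unfolding poly_bounded_def by (intro exI[of _ 1]) simp

lemma poly_bounded_add:
  assumes "poly_bounded f" "poly_bounded g"
  shows "poly_bounded (\<lambda>x. f x + g x)"
proof -
  from assms obtain c k c' k' where f: "\<forall>x\<ge>1. f x \<le> c * x ^ k" and g: "\<forall>x\<ge>1. g x \<le> c' * x ^ k'"
    unfolding poly_bounded_def by blast
  have "f x + g x \<le> (c + c') * x ^ (k + k')" if "x \<ge> 1" for x
  proof -
    have "c * x ^ k \<le> c * x ^ (k + k')" "c' * x ^ k' \<le> c' * x ^ (k + k')"
      using that by (auto intro!: mult_le_mono2 power_increasing simp del: mult_le_cancel1)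
    then show ?thesis
      using f[rule_format, OF that] g[rule_format, OF that] unfolding add_mult_distrib by linarith
  qed
  then show ?thesis unfolding poly_bounded_def by blast
qed

lemma poly_bounded_mult:
  assumes "poly_bounded f" "poly_bounded g"
  shows "poly_bounded (\<lambda>x. f x * g x)"
proof -
  from assms obtain c k c' k' where f: "\<forall>x\<ge>1. f x \<le> c * x ^ k" and g: "\<forall>x\<ge>1. g x \<le> c' * x ^ k'"
    unfolding poly_bounded_def by blast
  have "f x * g x \<le> (c * c') * x ^ (k + k')" if "x \<ge> 1" for x
    using mult_le_mono[OF f[rule_format, OF that] g[rule_format, OF that]]
    by (simp add: power_add mult_ac)
  then show ?thesis unfolding poly_bounded_def by blast
qed

text \<open>Loops are nested to a fixed depth, so unfolding leaves only sums and products of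
  \<open>X\<close> and constants.\<close>

lemma poly_bounded_zero_test_time: "poly_bounded zero_test_time"
proof -
  have "poly_bounded (\<lambda>X. zero_test_time X)"
    unfolding zero_test_time_def round_time_def gate_time_def op_time_def mul_time_def table_time_def
      loop_time_def
    by (intro poly_bounded_add poly_bounded_mult poly_bounded_const poly_bounded_id)
  then show ?thesis by simp
qed

section \<open>Bounds in terms of the instance size\<close>

lemma zero_test_correct:
  "\<exists>c k. \<forall>n d t. \<forall>C :: 'a::field circuit. promise n d t C \<longrightarrow>
     tests_zero_within zero_test n d t C (c * (length C + d + n + t) ^ k)"
proof -
  obtain c k where ck: "\<forall>x\<ge>1. zero_test_time x \<le> c * x ^ k"
    using poly_bounded_zero_test_time unfolding poly_bounded_def by blast
  \<comment> \<open>The choice is \<open>X = 9 * S ^ 4\<close>, where \<open>S\<close> is the sum of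
    the parameters: \<open>d + 2\<close> is at most \<open>3 * S\<close> and
    \<open>n * d * t + 2\<close> at most \<open>3 * S ^ 3\<close>. Inserting it into
    \<open>c * X ^ k\<close> gives the constant and the exponent.\<close>
  have "tests_zero_within zero_test n d t C ((c * 9 ^ k) * (length C + d + n + t) ^ (4 * k))"
    if promise: "promise n d t C" for n d t and C :: "'a circuit"
  proof -
    define S where "S = length C + d + n + t"
    \<comment> \<open>A circuit has at least one gate, so \<open>S\<close> is positive and its
      powers grow with the exponent.\<close>
    have "C \<noteq> []" using promise by (simp add: promise_def wf_circuit_def)
    then have S: "S \<ge> 1" by (cases C) (simp_all add: S_def)
    have le: "length C \<le> S" "d \<le> S" "n \<le> S" "t \<le> S" by (simp_all add: S_def)
    have "n * d * t \<le> S * S * S" by (intro mult_le_mono le)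
    moreover have pow: "1 \<le> S ^ 3" "S \<le> S ^ 3" "S ^ 3 \<le> S ^ 4" "S \<le> S ^ 4"
      using S power_increasing[of 1 3 S] power_increasing[of 3 4 S] power_increasing[of 1 4 S]
      by simp_all
    ultimately have M: "n * d * t + 2 \<le> 3 * S ^ 3" using power3_eq_cube[of S] by linarith
    have "(d + 2) * (n * d * t + 2) \<le> (3 * S) * (3 * S ^ 3)"
      using M le S by (intro mult_le_mono) simp_all
    also have "\<dots> = 9 * S ^ 4" by (simp add: power_numeral_reduce)
    finally have 1: "(d + 2) * (n * d * t + 2) \<le> 9 * S ^ 4" .
    have "n + 2 * (n * d * t + 2) \<le> S ^ 4 + 2 * (3 * S ^ 4)"
      using M le pow by (intro add_mono mult_le_mono2) linarith+
    then have 2: "n + 2 * (n * d * t + 2) \<le> 9 * S ^ 4" "t \<le> 9 * S ^ 4" "length C \<le> 9 * S ^ 4"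
      using le pow by simp_all
    have "zero_test_time (9 * S ^ 4) \<le> c * (9 * S ^ 4) ^ k"
      by (rule ck[rule_format]) (use pow in linarith)
    then have "zero_test_time (9 * S ^ 4) \<le> (c * 9 ^ k) * S ^ (4 * k)"
      by (simp add: power_mult_distrib power_mult mult.assoc)
    with runs_zero_test[OF promise 1 2] show ?thesis
      unfolding runs_def tests_zero_within_def S_def by (meson order_trans)
  qed
  then show ?thesis by blast
qed

lemma tests_zero_within_mono:
  "tests_zero_within P n d t C B \<Longrightarrow> B \<le> B' \<Longrightarrow> tests_zero_within P n d t C B'"
  unfolding tests_zero_within_def by (meson order_trans)

theorem theorem2:
  shows "\<exists>P :: com.
    (\<exists>c k. \<forall>n d t. \<forall>C :: 'a::field circuit. promise n d t C \<longrightarrow>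
       tests_zero_within P n d t C (c * (circuit_size C + d + n + t) ^ k)) \<and>
    (\<forall>a b. \<exists>c k. \<forall>n d t. \<forall>C :: 'a::field circuit. promise n d t C \<longrightarrow>
       d \<le> a * (circuit_size C + n) ^ b \<longrightarrow> t \<le> a * (circuit_size C + n) ^ b \<longrightarrow>
       tests_zero_within P n d t C (c * (circuit_size C + n) ^ k))"
proof (rule exI[of _ zero_test], rule conjI)
  obtain c k where ck: "tests_zero_within zero_test n d t C (c * (circuit_size C + d + n + t) ^ k)"
    if "promise n d t C" for n d t and C :: "'a circuit"
    using zero_test_correct by blast
  then show "\<exists>c k. \<forall>n d t. \<forall>C :: 'a circuit. promise n d t C \<longrightarrow>
       tests_zero_within zero_test n d t C (c * (circuit_size C + d + n + t) ^ k)"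
    by blast
  show "\<forall>a b. \<exists>c k. \<forall>n d t. \<forall>C :: 'a circuit. promise n d t C \<longrightarrow>
       d \<le> a * (circuit_size C + n) ^ b \<longrightarrow> t \<le> a * (circuit_size C + n) ^ b \<longrightarrow>
       tests_zero_within zero_test n d t C (c * (circuit_size C + n) ^ k)"
  proof (intro allI)
    fix a b :: nat
    \<comment> \<open>The exponent \<open>b + 1\<close> dominates both 1 and \<open>b\<close>, so
      \<open>circuit_size C + n\<close> and the bounds on \<open>d\<close> and \<open>t\<close>
      together stay below \<open>(1 + 2 * a) * (circuit_size C + n) ^ (b + 1)\<close>, even for
      \<open>b = 0\<close>.\<close>
    have "tests_zero_within zero_test n d t C
        ((c * (1 + 2 * a) ^ k) * (circuit_size C + n) ^ ((b + 1) * k))"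
      if promise: "promise n d t C" and d: "d \<le> a * (circuit_size C + n) ^ b"
        and t: "t \<le> a * (circuit_size C + n) ^ b" for n d t and C :: "'a circuit"
    proof -
      define S where "S = circuit_size C + n"
      have "C \<noteq> []" using promise by (simp add: promise_def wf_circuit_def)
      then have "S \<ge> 1" by (cases C) (simp_all add: S_def)
      then have "S ^ 1 \<le> S ^ (b + 1)" "a * S ^ b \<le> a * S ^ (b + 1)"
        by (intro mult_le_mono2 power_increasing; simp)+
      then have "circuit_size C + d + n + t \<le> (1 + 2 * a) * S ^ (b + 1)"
        using d t unfolding S_def add_mult_distrib mult_1 power_one_right mult.assoc by linarith
      then have "c * (circuit_size C + d + n + t) ^ k \<le> c * ((1 + 2 * a) * S ^ (b + 1)) ^ k"
        by (intro mult_le_mono2 power_mono) simp_all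
      also have "\<dots> = (c * (1 + 2 * a) ^ k) * S ^ ((b + 1) * k)"
        by (simp only: power_mult_distrib power_mult mult.assoc)
      finally show ?thesis
        using ck[OF promise] tests_zero_within_mono unfolding S_def by blast
    qed
    then show "\<exists>c k. \<forall>n d t. \<forall>C :: 'a circuit. promise n d t C \<longrightarrow>
       d \<le> a * (circuit_size C + n) ^ b \<longrightarrow> t \<le> a * (circuit_size C + n) ^ b \<longrightarrow>
       tests_zero_within zero_test n d t C (c * (circuit_size C + n) ^ k)"
      by blast
  qed
qed

end
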